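(* Let $(S,d)$ be a complete, separable metric space equipped with an origin $0_S$ and a scalar multiplication. Let $X$ be a random element in $S$ and let $\alpha\in(0,\infty)$. Assume that a modulus $\rho:S\to[0,\infty)$ exists. Write $\aleph=\{x\in S:\rho(x)=1\}$ and $\theta(x)=\rho(x)^{-1}x$ for $x\in S_0=S\setminus\{0_S\}$. The following properties are equivalent: (i) $X$ is regularly varying with index $\alpha>0$. (ii) The function $u\mapsto\Pr[\rho(X)>u]$ is in $\mathcal{R}_{-\alpha}$ and there exists a probability measure $H$ on $\aleph$ such that $$\mathcal{L}(\theta(X)\mid\rho(X)>u)\rightsquigarrow H,\qquad u\to\infty.$$ (iii) There exists a probability measure $H$ on $\aleph$ such that $$\mathcal{L}(\rho(X)/u,\theta(X)\mid\rho(X)>u)\rightsquigarrow\operatorname{Pareto}(\alpha)\otimes H,\qquad u\to\infty.$$ In that case, we have $$\frac{1}{\Pr[\rho(X)>u]}\Pr[u^{-1}X\in\,\cdot\,]\to\mu\quad\text{in }M_0(S),\qquad u\to\infty,$$ where $\mu$ is determined by $$\mu\circ T^{-1}(dr,d\theta)=\alpha r^{-\alpha-1}\,dr\,H(d\theta),\qquad(r,\theta)\in(0,\infty)\times\aleph,$$ with $T:S_0\to(0,\infty)\times\aleph$, $T(x)=(\rho(x),\theta(x))$.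
   Context: Scalar multiplication: $S$ has a distinguished point $0_S$ (the origin), $S\neq\{0_S\}$, and a scalar multiplication on $S$ is a map $[0,\infty)\times S\to S:(\lambda,x)\mapsto\lambda x$ such that (i) $\lambda_1(\lambda_2x)=(\lambda_1\lambda_2)x$; (ii) $1x=x$; (iii) the map is continuous with respect to the product topology; (iv) if $x\in S_0=S\setminus\{0_S\}$ and $0\le\lambda_1<\lambda_2$, then $d(\lambda_1x,0_S)<d(\lambda_2x,0_S)$. Modulus: a function $\rho:S\to[0,\infty)$ is a modulus if (i) $\rho$ is continuous; (ii) $\rho(\lambda x)=\lambda\rho(x)$ for $\lambda\in[0,\infty)$, $x\in S$; (iii) for every $\varepsilon>0$, $\inf\{\rho(x):d(x,0_S)>\varepsilon\}>0$. (In particular $\rho(x)=0$ iff $x=0_S$.) Measures: $M_0(S)$ is the space of Borel measures on $S_0$ that are finite on complements of neighbourhoods of $0_S$. Convergence $\mu_n\to\mu$ in $M_0(S)$ means $\int f\,d\mu_n\to\int f\,d\mu$ for every bounded continuous $f:S_0\to\mathbb{R}$ that vanishes on $\{x:d(x,0_S)<r\}$ for some $r>0$. Regular variation: for $\tau\in\mathbb{R}$, $\mathcal{R}_\tau$ is the class of positive measurable functions $g$ defined in a neighbourhood of infinity with $\lim_{u\to\infty}g(\lambda u)/g(u)=\lambda^\tau$ for every $\lambda\in(0,\infty)$. A random element $X$ in $S$ is regularly varying with index $\alpha\in(0,\infty)$ if there exist $V\in\mathcal{R}_{-\alpha}$ and a nonzero $\mu\in M_0(S)$ such that $V(u)^{-1}\Pr[u^{-1}X\in\,\cdot\,]\to\mu$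 in $M_0(S)$ as $u\to\infty$. Other notation: $\rightsquigarrow$ is convergence in distribution; $\mathcal{L}(Y\mid A)$ is the law of $Y$ conditionally on the event $A$; $\operatorname{Pareto}(\alpha)$ is the law of a random variable $Y$ with $\Pr(Y>y)=y^{-\alpha}$ for $y\in[1,\infty)$; $\otimes$ is product measure. *)

theory Defs
  imports "HOL-Probability.Probability"
begin

text \<open>Only the values \<open>smul l x\<close> with \<open>0 \<le> l\<close> are meaningful.\<close>

definition scalar_mult :: "'a::metric_space \<Rightarrow> (real \<Rightarrow> 'a \<Rightarrow> 'a) \<Rightarrow> bool" where
  "scalar_mult z smul \<longleftrightarrow>
     (\<forall>l1 l2 x. 0 \<le> l1 \<longrightarrow> 0 \<le> l2 \<longrightarrow> smul l1 (smul l2 x) = smul (l1 * l2) x) \<and>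
     (\<forall>x. smul 1 x = x) \<and>
     continuous_on ({0..} \<times> UNIV) (\<lambda>(l, x). smul l x) \<and>
     (\<forall>x l1 l2. x \<noteq> z \<longrightarrow> 0 \<le> l1 \<longrightarrow> l1 < l2 \<longrightarrow> dist (smul l1 x) z < dist (smul l2 x) z)"

text \<open>The infimum is taken in \<^typ>\<open>ennreal\<close>, so that it is infinite over the empty set:
  a bounded space has no points at distance more than \<open>e\<close> from the origin when \<open>e\<close> is large.\<close>

definition modulus :: "'a::metric_space \<Rightarrow> (real \<Rightarrow> 'a \<Rightarrow> 'a) \<Rightarrow> ('a \<Rightarrow> real) \<Rightarrow> bool" where
  "modulus z smul \<rho> \<longleftrightarrow>
     (\<forall>x. 0 \<le> \<rho> x) \<and>
     continuous_on UNIV \<rho> \<and>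
     (\<forall>l x. 0 \<le> l \<longrightarrow> \<rho> (smul l x) = l * \<rho> x) \<and>
     (\<forall>e>0. 0 < (INF x\<in>{x. e < dist x z}. ennreal (\<rho> x)))"

definition unit_sphere :: "('a \<Rightarrow> real) \<Rightarrow> 'a set" where
  "unit_sphere \<rho> = {x. \<rho> x = 1}"

definition angle :: "(real \<Rightarrow> 'a \<Rightarrow> 'a) \<Rightarrow> ('a \<Rightarrow> real) \<Rightarrow> 'a \<Rightarrow> 'a" where
  "angle smul \<rho> x = smul (inverse (\<rho> x)) x"

text \<open>Measures on a Borel subset \<open>A\<close> of a space are measures whose underlying measurable space is
  \<^term>\<open>restrict_space borel A\<close>.\<close>

definition prob_on :: "'a::topological_space set \<Rightarrow> 'a measure \<Rightarrow> bool" where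
  "prob_on A H \<longleftrightarrow> sets H = sets (restrict_space borel A) \<and> prob_space H"

definition M0 :: "'a::metric_space \<Rightarrow> 'a measure set" where
  "M0 z = {\<mu>. sets \<mu> = sets (restrict_space borel (- {z})) \<and>
              (\<forall>U. open U \<longrightarrow> z \<in> U \<longrightarrow> emeasure \<mu> (- U) < \<infinity>)}"

definition M0_tendsto ::
  "'a::metric_space \<Rightarrow> ('i \<Rightarrow> 'a measure) \<Rightarrow> 'a measure \<Rightarrow> 'i filter \<Rightarrow> bool" where
  "M0_tendsto z \<mu>s \<mu> F \<longleftrightarrow>
     (\<forall>\<^sub>F u in F. \<mu>s u \<in> M0 z) \<and> \<mu> \<in> M0 z \<and>
     (\<forall>f :: 'a \<Rightarrow> real.
        continuous_on (- {z}) f \<and> bounded (f ` (- {z})) \<and>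
        (\<exists>r>0. \<forall>x. x \<noteq> z \<longrightarrow> dist x z < r \<longrightarrow> f x = 0) \<longrightarrow>
        ((\<lambda>u. \<integral>x. f x \<partial>\<mu>s u) \<longlongrightarrow> (\<integral>x. f x \<partial>\<mu>)) F)"

text \<open>The law of \<open>u\<^sup>-\<^sup>1 X\<close>, seen as a measure on the space without its origin.\<close>

definition scaled_law ::
  "'a::metric_space \<Rightarrow> (real \<Rightarrow> 'a \<Rightarrow> 'a) \<Rightarrow> 'b measure \<Rightarrow> ('b \<Rightarrow> 'a) \<Rightarrow> real \<Rightarrow> 'a measure" where
  "scaled_law z smul M X u =
     restrict_space (distr M borel (\<lambda>\<omega>. smul (inverse u) (X \<omega>))) (- {z})"

text \<open>The class \<open>\<R>\<^sub>\<tau>\<close>: only the values of \<open>g\<close> near infinity matter.\<close>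

definition reg_var :: "real \<Rightarrow> (real \<Rightarrow> real) \<Rightarrow> bool" where
  "reg_var \<tau> g \<longleftrightarrow>
     (\<exists>u0. g \<in> borel_measurable (restrict_space borel {u0<..}) \<and> (\<forall>u>u0. 0 < g u)) \<and>
     (\<forall>l>0. ((\<lambda>u. g (l * u) / g u) \<longlongrightarrow> l powr \<tau>) at_top)"

definition regularly_varying ::
  "'a::metric_space \<Rightarrow> (real \<Rightarrow> 'a \<Rightarrow> 'a) \<Rightarrow> 'b measure \<Rightarrow> ('b \<Rightarrow> 'a) \<Rightarrow> real \<Rightarrow> bool" where
  "regularly_varying z smul M X \<alpha> \<longleftrightarrow>
     (\<exists>V \<mu>. reg_var (- \<alpha>) V \<and> \<mu> \<in> M0 z \<and> emeasure \<mu> (space \<mu>) \<noteq> 0 \<and>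
        M0_tendsto z (\<lambda>u. scale_measure (ennreal (inverse (V u))) (scaled_law z smul M X u)) \<mu> at_top)"

text \<open>Convergence in distribution on the subspace \<open>A\<close> of a topological space.\<close>

definition weak_tendsto ::
  "'a::topological_space set \<Rightarrow> ('i \<Rightarrow> 'a measure) \<Rightarrow> 'a measure \<Rightarrow> 'i filter \<Rightarrow> bool" where
  "weak_tendsto A \<nu>s \<nu> F \<longleftrightarrow>
     (\<forall>f :: 'a \<Rightarrow> real. continuous_on A f \<and> bounded (f ` A) \<longrightarrow>
        ((\<lambda>u. \<integral>x. f x \<partial>\<nu>s u) \<longlongrightarrow> (\<integral>x. f x \<partial>\<nu>)) F)"

text \<open>The law of \<open>Y\<close>, with values in \<open>N\<close>, given the event \<open>A\<close>. Restricting to \<open>A\<close> allows for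
  variables \<open>Y\<close> that take values in \<open>N\<close> on \<open>A\<close> only, such as the angle of \<open>X\<close>, which is not on
  the unit sphere when \<open>X\<close> is the origin. The result is the zero measure, hence no law,
  if \<open>A\<close> has probability zero.\<close>

definition cond_law :: "'b measure \<Rightarrow> 'b set \<Rightarrow> 'c measure \<Rightarrow> ('b \<Rightarrow> 'c) \<Rightarrow> 'c measure" where
  "cond_law M A N Y = distr (restrict_space (uniform_measure M A) A) N Y"

text \<open>The Borel measure on the real line with distribution function
  \<open>y \<mapsto> 1 - y\<^sup>-\<^sup>\<alpha>\<close> for \<open>y \<ge> 1\<close>; see \<open>measure_pareto\<close> below.\<close>

definition pareto :: "real \<Rightarrow> real measure" where
  "pareto \<alpha> = interval_measure (\<lambda>y. if y < 1 then 0 else 1 - y powr (- \<alpha>))"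

lemma
  assumes "0 < \<alpha>"
  shows real_distribution_pareto: "real_distribution (pareto \<alpha>)"
    and measure_pareto: "\<And>y. 1 \<le> y \<Longrightarrow> measure (pareto \<alpha>) {y<..} = y powr (- \<alpha>)"
proof -
  let ?F = "\<lambda>y::real. if y < 1 then 0 else 1 - y powr (- \<alpha>)"
  have le1: "y powr (- \<alpha>) \<le> 1" if "1 \<le> y" for y
    using powr_mono[of "- \<alpha>" 0 y] that assms by simp
  have mono: "?F x \<le> ?F y" if "x \<le> y" for x y
    using that le1[of y] powr_mono2'[of "- \<alpha>" x y] assms by auto
  have cont: "continuous (at_right a) ?F" for a
  proof (cases "a < 1")
    case True
    have "\<forall>\<^sub>F y in at_right a. y < 1"
      using True eventually_at_right_less eventually_at_right by blast
    then have "\<forall>\<^sub>F y in at_right a. ?F y = 0" by eventually_elim simp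
    then show ?thesis using True by (simp add: continuous_within tendsto_eventually)
  next
    case False
    have "((\<lambda>y. 1 - y powr (- \<alpha>)) \<longlongrightarrow> 1 - a powr (- \<alpha>)) (at_right a)"
      using False by (intro tendsto_intros) auto
    moreover have "\<forall>\<^sub>F y in at_right a. 1 - y powr (- \<alpha>) = ?F y"
      using eventually_at_right_less[of a] by (rule eventually_mono) (use False in auto)
    ultimately have "(?F \<longlongrightarrow> 1 - a powr (- \<alpha>)) (at_right a)"
      by (rule Lim_transform_eventually)
    then show ?thesis using False by (simp add: continuous_within)
  qed
  have bot: "(?F \<longlongrightarrow> 0) at_bot"
    by (rule tendsto_eventually) (rule eventually_mono[OF eventually_gt_at_bot[of "1::real"]], simp)
  have "((\<lambda>y::real. 1 - y powr (- \<alpha>)) \<longlongrightarrow> 1 - 0) at_top"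
    using assms by (intro tendsto_intros tendsto_neg_powr filterlim_ident) auto
  moreover have "\<forall>\<^sub>F y in at_top. 1 - y powr (- \<alpha>) = ?F y"
    using eventually_ge_at_top[of 1] by eventually_elim auto
  ultimately have top: "(?F \<longlongrightarrow> 1) at_top"
    by (auto intro: Lim_transform_eventually)
  show 1: "real_distribution (pareto \<alpha>)"
    unfolding pareto_def by (rule real_distribution_interval_measure[OF mono cont bot top])
  then interpret P: real_distribution "pareto \<alpha>" .
  show "measure (pareto \<alpha>) {y<..} = y powr (- \<alpha>)" if "1 \<le> y" for y
  proof -
    have "cdf (pareto \<alpha>) = ?F"
      unfolding pareto_def by (rule cdf_interval_measure[OF mono cont bot])
    then have "measure (pareto \<alpha>) {..y} = 1 - y powr (- \<alpha>)"
      using that by (simp add: cdf_def fun_eq_iff)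
    moreover have "{y<..} = space (pareto \<alpha>) - {..y}" by auto
    ultimately show ?thesis using P.prob_compl[of "{..y}"] by simp
  qed
qed

end

theory Submission
  imports Defs
begin

text \<open>In the polar coordinates \<open>(\<rho>, \<theta>)\<close> the space without its origin is
  \<open>(0, \<infinity>) \<times> \<aleph>\<close>, and a set stays away from the origin iff \<open>\<rho>\<close> is bounded below on it.

  (i) implies (ii): convergence along \<open>u\<close> and along \<open>\<lambda> u\<close> shows that \<open>\<mu>\<close> is homogeneous, so
  \<open>\<integral> 1{\<rho> > a} k(\<theta>) d\<mu> = a\<^sup>-\<^sup>\<alpha> \<integral> 1{\<rho> > 1} k(\<theta>) d\<mu>\<close>. As this is continuous in \<open>a\<close>,
  squeezing indicators between continuous ramps gives convergence for the discontinuous functions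
  \<open>1{\<rho> > a} k(\<theta>)\<close>, and \<open>H\<close> is the law of \<open>\<theta>\<close> under \<open>\<mu>\<close> conditioned on \<open>\<rho> > 1\<close>.

  (ii) implies (iii): (ii) says that the conditional laws converge on the functions
  \<open>1{r > a} k(\<theta>)\<close>, and these determine weak convergence on the product.

  (iii) implies convergence in \<open>M\<^sub>0\<close>, hence (i): a test function that vanishes for \<open>\<rho> \<le> c\<close> only sees
  the law of \<open>(\<rho>(X) / (c u), \<theta>(X))\<close> given \<open>\<rho>(X) > c u\<close>, and the probability of this event is
  asymptotically \<open>c\<^sup>-\<^sup>\<alpha> Pr[\<rho>(X) > u]\<close>. The limit measure restricted to \<open>\<rho> > c\<close> is a rescaled
  Pareto law in the same way.\<close>

section \<open>Conditional laws, ramps and infima of continuous functions\<close>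

text \<open>The hypotheses concern continuous test functions, whereas the conclusions condition on
  \<open>\<rho> > u\<close>, an event whose indicator jumps. Every passage between the two is a
  monotone comparison in the threshold, packaged in \<open>tendsto_squeeze_thresholds\<close>.
  Monotonicity needs \<open>k \<ge> 0\<close>; a bounded \<open>k\<close> is shifted by a constant,
  which changes the integrals by a multiple of the tail probability, and that multiple is controlled
  by the case \<open>k = 1\<close>.

  The squeeze is needed twice, since (iii) does not assume that the tail probability varies
  regularly. This has to be read off the radial marginal, which sees only thresholds above
  \<open>u\<close>; ratios with \<open>l < 1\<close> then come from those with \<open>l > 1\<close>
  by inversion.

  In (i) the normalising function \<open>V\<close> is arbitrary in its class. The case
  \<open>k = 1\<close> shows that the tail probability divided by \<open>V\<close> has a positive
  limit, and this is what removes \<open>V\<close> from the conditional laws.\<close>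

lemma integral_scale_measure:
  fixes f :: "'a \<Rightarrow> real"
  assumes "0 \<le> c" "f \<in> borel_measurable N"
  shows "(\<integral>x. f x \<partial>scale_measure (ennreal c) N) = c * (\<integral>x. f x \<partial>N)"
proof -
  have "scale_measure (ennreal c) N = density N (\<lambda>_. ennreal c)"
    by (intro measure_eqI) (auto simp: emeasure_density nn_integral_cmult_indicator)
  then show ?thesis using assms by (simp add: integral_density)
qed

lemma uniform_measure_eq_density_real:
  assumes "A \<in> sets N" "emeasure N A \<noteq> \<infinity>"
  shows "uniform_measure N A = density N (\<lambda>x. ennreal (indicator A x / measure N A))"
proof (cases "measure N A = 0")
  case True
  then have 0: "A \<in> null_sets N"
    using assms by (simp add: emeasure_eq_ennreal_measure null_sets_def)
  \<comment> \<open>Here the two densities differ on \<open>A\<close>, since \<open>1 / 0\<close> is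
    infinite in \<open>ennreal\<close> and zero in the reals; but \<open>A\<close> is null.\<close>
  show ?thesis unfolding uniform_measure_def
    by (rule density_cong) (use assms True AE_not_in[OF 0] in auto)
next
  case False
  then have "0 < measure N A" by (simp add: less_le)
  then have "indicator A x / emeasure N A = ennreal (indicator A x / measure N A)" for x
    using assms(2) by (auto simp: emeasure_eq_ennreal_measure divide_ennreal indicator_def
        simp flip: ennreal_1)
  then show ?thesis by (simp add: uniform_measure_def)
qed

text \<open>Stated for an arbitrary measure because it serves both the probability space and the
  limit measure \<open>\<mu>\<close>, of which only the mass away from the origin is known to be
  finite. For a null event both sides are zero.\<close>

lemma integral_cond_law:
  fixes f :: "'c \<Rightarrow> real"
  assumes A: "A \<in> sets N" "emeasure N A \<noteq> \<infinity>"
    and Y: "Y \<in> measurable (restrict_space N A) K" and f: "f \<in> borel_measurable K"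
  shows "(\<integral>y. f y \<partial>cond_law N A K Y) = (\<integral>x. indicator A x * f (Y x) \<partial>N) / measure N A"
proof -
  have sets: "sets (restrict_space (uniform_measure N A) A) = sets (restrict_space N A)"
    by (intro sets_restrict_space_cong) simp
  have Y': "Y \<in> measurable (restrict_space (uniform_measure N A) A) K"
    using Y by (simp add: measurable_cong_sets[OF sets refl])
  have "(\<lambda>x. f (Y x)) \<in> borel_measurable (restrict_space N A)"
    using Y f by simp
  then have m: "(\<lambda>x. indicator A x * f (Y x)) \<in> borel_measurable N"
    using A by (simp add: borel_measurable_restrict_space_iff)
  have "(\<integral>y. f y \<partial>cond_law N A K Y) = (\<integral>x. f (Y x) \<partial>restrict_space (uniform_measure N A) A)"
    unfolding cond_law_def by (rule integral_distr[OF Y' f])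
  also have "\<dots> = (\<integral>x. indicator A x * f (Y x) \<partial>uniform_measure N A)"
    using A by (subst integral_restrict_space) auto
  also have "\<dots> = (\<integral>x. indicator A x / measure N A * (indicator A x * f (Y x)) \<partial>N)"
    unfolding uniform_measure_eq_density_real[OF A] using A m
    by (subst integral_density) auto
  also have "\<dots> = (\<integral>x. (indicator A x * f (Y x)) / measure N A \<partial>N)"
    by (intro Bochner_Integration.integral_cong) (auto simp: indicator_def)
  finally show ?thesis by simp
qed

lemma sets_cond_law [simp]: "sets (cond_law N A K Y) = sets K"
  by (simp add: cond_law_def)

lemma prob_space_cond_law:
  assumes "A \<in> sets N" "emeasure N A \<noteq> 0" "emeasure N A \<noteq> \<infinity>"
    and Y: "Y \<in> measurable (restrict_space N A) K"
  shows "prob_space (cond_law N A K Y)"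
proof -
  have sets: "sets (restrict_space (uniform_measure N A) A) = sets (restrict_space N A)"
    by (intro sets_restrict_space_cong) simp
  have "prob_space (restrict_space (uniform_measure N A) A)"
    using assms sets.sets_into_space[OF assms(1)]
    by (intro prob_spaceI)
      (simp add: space_restrict_space emeasure_restrict_space Int_absorb2 ennreal_divide_self top.not_eq_extremum)
  moreover have "Y \<in> measurable (restrict_space (uniform_measure N A) A) K"
    using Y by (simp add: measurable_cong_sets[OF sets refl])
  ultimately show ?thesis unfolding cond_law_def by (rule prob_space.prob_space_distr)
qed

text \<open>The analytic core of a portmanteau argument. Think of \<open>q u a\<close> as the mass
  beyond the threshold \<open>a\<close> and of \<open>p u b a\<close> as the integral of a ramp
  rising from \<open>b\<close> to \<open>a\<close>. Ramps on either side of \<open>a\<close> enclose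
  \<open>q u a\<close>; their limits are enclosed by values of \<open>h\<close>, and letting the
  other end of the ramp tend to \<open>a\<close> leaves \<open>h a\<close> by continuity.\<close>

lemma tendsto_squeeze_thresholds:
  fixes q :: "'i \<Rightarrow> real \<Rightarrow> real" and p :: "'i \<Rightarrow> real \<Rightarrow> real \<Rightarrow> real"
  assumes q: "\<And>b a. c \<le> b \<Longrightarrow> b < a \<Longrightarrow> \<forall>\<^sub>F u in F. q u a \<le> p u b a \<and> p u b a \<le> q u b"
    and p: "\<And>b a. c < b \<Longrightarrow> b < a \<Longrightarrow> ((\<lambda>u. p u b a) \<longlongrightarrow> l b a) F"
    and l: "\<And>b a. c < b \<Longrightarrow> b < a \<Longrightarrow> h a \<le> l b a \<and> l b a \<le> h b"
    and "c < a" and h: "isCont h a"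
  shows "((\<lambda>u. q u a) \<longlongrightarrow> h a) F"
proof (rule order_tendstoI)
  fix y assume "y < h a"
  then have "\<forall>\<^sub>F b in at a. y < h b" using h by (auto simp: isCont_def order_tendsto_iff)
  then have "\<forall>\<^sub>F b in at_right a. y < h b" by (simp add: eventually_at_split)
  then obtain b where b: "a < b" "y < h b"
    by (metis eventually_at_right_field gt_ex dense)
  then have "y < l a b" using l[of a b] \<open>c < a\<close> by auto
  then have "\<forall>\<^sub>F u in F. y < p u a b" using p[of a b] b \<open>c < a\<close> by (auto simp: order_tendsto_iff)
  moreover have "\<forall>\<^sub>F u in F. q u b \<le> p u a b \<and> p u a b \<le> q u a" using q[of a b] b \<open>c < a\<close> by auto
  ultimately show "\<forall>\<^sub>F u in F. y < q u a" by eventually_elim auto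
next
  fix y assume "h a < y"
  then have "\<forall>\<^sub>F b in at a. h b < y" using h by (auto simp: isCont_def order_tendsto_iff)
  then have "\<forall>\<^sub>F b in at_left a. h b < y" by (simp add: eventually_at_split)
  then obtain b0 where "b0 < a" "\<And>b. b0 < b \<Longrightarrow> b < a \<Longrightarrow> h b < y"
    by (metis eventually_at_left_field)
  moreover obtain b where "max b0 c < b" "b < a"
    using dense[of "max b0 c" a] \<open>b0 < a\<close> \<open>c < a\<close> by auto
  ultimately have b: "c < b" "b < a" "h b < y" by auto
  then have "l b a < y" using l[of b a] by auto
  then have "\<forall>\<^sub>F u in F. p u b a < y" using p[of b a] b by (auto simp: order_tendsto_iff)
  moreover have "\<forall>\<^sub>F u in F. q u a \<le> p u b a \<and> p u b a \<le> q u b" using q[of b a] b by auto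
  ultimately show "\<forall>\<^sub>F u in F. q u a < y" by eventually_elim auto
qed

definition ramp :: "real \<Rightarrow> real \<Rightarrow> real \<Rightarrow> real" where
  "ramp b a r = max 0 (min 1 ((r - b) / (a - b)))"

lemma continuous_on_ramp [continuous_intros]:
  "continuous_on S f \<Longrightarrow> continuous_on S (\<lambda>x. ramp b a (f x))"
  unfolding ramp_def divide_inverse by (intro continuous_intros)

lemma borel_measurable_ramp [measurable]: "ramp b a \<in> borel_measurable borel"
  by (intro borel_measurable_continuous_onI continuous_intros)

lemma ramp_bounds:
  assumes "b < a"
  shows "indicator {a<..} r \<le> ramp b a r" "ramp b a r \<le> indicator {b<..} r"
  using assms by (auto simp: ramp_def indicator_def divide_simps)

text \<open>Used to trade a change of thresholds for a change of the scale \<open>u\<close>, which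
  is how homogeneity of the limit measure is obtained.\<close>

lemma ramp_mult: "0 < l \<Longrightarrow> ramp (l * b) (l * a) (l * r) = ramp b a r"
  by (simp add: ramp_def flip: right_diff_distrib)

lemma ramp_nonneg: "0 \<le> ramp b a r" and ramp_le_1: "ramp b a r \<le> 1"
  by (auto simp: ramp_def)

text \<open>Second countability identifies the Borel sets of the product with the product
  sigma-algebra; what remains is that the identity is measurable from the product of the traces to
  the trace on \<open>A \<times> B\<close>.\<close>

lemma borel_measurable_continuous_on_Times:
  fixes f :: "'a::second_countable_topology \<times> 'b::second_countable_topology \<Rightarrow> 'c::topological_space"
  assumes "continuous_on (A \<times> B) f"
  shows "f \<in> measurable (restrict_space borel A \<Otimes>\<^sub>M restrict_space borel B) borel"
proof -
  have "(\<lambda>p. p) \<in> measurable (restrict_space borel A \<Otimes>\<^sub>M restrict_space borel B)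
      (restrict_space (borel \<Otimes>\<^sub>M borel) (A \<times> B))"
    by (intro measurable_restrict_space2)
      (auto simp: space_pair_measure space_restrict_space
        intro!: measurable_pair measurable_compose[OF measurable_fst] measurable_compose[OF measurable_snd]
          measurable_restrict_space1 simp: comp_def)
  moreover have "f \<in> borel_measurable (restrict_space (borel \<Otimes>\<^sub>M borel) (A \<times> B))"
    using borel_measurable_continuous_on_restrict[OF assms] by (simp add: borel_prod)
  ultimately show ?thesis by (rule measurable_compose)
qed

text \<open>By compactness of \<open>C\<close>, points \<open>y\<close> near \<open>x\<close>
  satisfy \<open>\<bar>f y t - f x t\<bar> \<le> e / 2\<close> for all \<open>t \<in> C\<close> at
  once, and a uniform bound passes to the infima.\<close>

lemma continuous_on_INF_compact:
  fixes f :: "'a::topological_space \<Rightarrow> 'b::topological_space \<Rightarrow> real"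
  assumes f: "continuous_on (A \<times> C) (\<lambda>(x, t). f x t)" and "compact C" "C \<noteq> {}"
  shows "continuous_on A (\<lambda>x. INF t\<in>C. f x t)"
proof (unfold continuous_on_def tendsto_iff, intro ballI allI impI)
  fix x and e :: real
  assume x: "x \<in> A" and "0 < e"
  then obtain X where X: "x \<in> X" "open X" 
    "\<forall>y\<in>X \<inter> A. \<forall>t\<in>C. dist (case (y, t) of (x, t) \<Rightarrow> f x t) (case (x, t) of (x, t) \<Rightarrow> f x t) \<le> e / 2"
    using continuous_on_prod_compactE[OF f \<open>compact C\<close>, of x "e / 2"] by auto
  have bdd: "bdd_below (f y ` C)" if "y \<in> A" for y
  proof -
    have "continuous_on C (\<lambda>t. case (y, t) of (x, t) \<Rightarrow> f x t)"
      by (rule continuous_on_compose2[OF f]) (use that in \<open>auto intro!: continuous_intros\<close>)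
    then have "compact (f y ` C)" using \<open>compact C\<close> by (auto intro: compact_continuous_image)
    then show ?thesis by (simp add: bounded_imp_bdd_below compact_imp_bounded)
  qed
  have "dist (INF t\<in>C. f y t) (INF t\<in>C. f x t) < e" if y: "y \<in> X \<inter> A" for y
  proof -
    have d: "f y t - e / 2 \<le> f x t" "f x t - e / 2 \<le> f y t" if "t \<in> C" for t
    proof -
      have "\<bar>f y t - f x t\<bar> \<le> e / 2"
        using X(3) y that by (auto simp: dist_real_def)
      then show "f y t - e / 2 \<le> f x t" "f x t - e / 2 \<le> f y t" by linarith+
    qed
    have "(INF t\<in>C. f y t) - e / 2 \<le> (INF t\<in>C. f x t)"
    proof (rule cINF_greatest[OF \<open>C \<noteq> {}\<close>])
      fix t assume "t \<in> C"
      then show "(INF t\<in>C. f y t) - e / 2 \<le> f x t"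
        using cINF_lower[OF bdd \<open>t \<in> C\<close>, of y] d[of t] y by fastforce
    qed
    moreover have "(INF t\<in>C. f x t) - e / 2 \<le> (INF t\<in>C. f y t)"
    proof (rule cINF_greatest[OF \<open>C \<noteq> {}\<close>])
      fix t assume "t \<in> C"
      then show "(INF t\<in>C. f x t) - e / 2 \<le> f y t"
        using cINF_lower[OF bdd \<open>t \<in> C\<close>, of x] d[of t] x by fastforce
    qed
    ultimately show ?thesis using \<open>0 < e\<close> by (simp add: dist_real_def)
  qed
  then show "\<forall>\<^sub>F y in at x within A. dist (INF t\<in>C. f y t) (INF t\<in>C. f x t) < e"
    using X(1,2) by (auto simp: eventually_at_topological)
qed

section \<open>Weak convergence on the product of the line with a space\<close>

text \<open>A nonnegative continuous function is the limit of the smaller functions that replace it on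
  each cell \<open>((j - 1) / n, j / n]\<close> of the line by its infimum over the cell. As the infimum over
  the closed cell is continuous in the second variable, the integrals of these step functions are
  covered by the hypothesis.\<close>

lemma weak_tendsto_from_half_lines:
  fixes A :: "'a::{second_countable_topology} set" and \<nu> :: "'i \<Rightarrow> (real \<times> 'a) measure"
  assumes \<nu>: "\<forall>\<^sub>F u in F. prob_space (\<nu> u)"
    and sets_\<nu>: "\<And>u. sets (\<nu> u) = sets (borel \<Otimes>\<^sub>M restrict_space borel A)"
    and Q: "prob_space Q" and sets_Q: "sets Q = sets (borel \<Otimes>\<^sub>M restrict_space borel A)"
    and conv: "\<And>a (k :: 'a \<Rightarrow> real). continuous_on A k \<Longrightarrow> bounded (k ` A) \<Longrightarrow>
      ((\<lambda>u. \<integral>p. indicator {a<..} (fst p) * k (snd p) \<partial>\<nu> u)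
        \<longlongrightarrow> (\<integral>p. indicator {a<..} (fst p) * k (snd p) \<partial>Q)) F"
  shows "weak_tendsto (UNIV \<times> A) \<nu> Q F"
proof -
  interpret Q: prob_space Q by fact
  have space_\<nu>: "space (\<nu> u) = UNIV \<times> A" for u
    by (simp add: sets_eq_imp_space_eq[OF sets_\<nu>] space_pair_measure space_restrict_space)
  have space_Q: "space Q = UNIV \<times> A"
    by (simp add: sets_eq_imp_space_eq[OF sets_Q] space_pair_measure space_restrict_space)
  have meas: "f \<in> borel_measurable (borel \<Otimes>\<^sub>M restrict_space borel A)"
    if "continuous_on (UNIV \<times> A) f" for f :: "real \<times> 'a \<Rightarrow> real"
    using borel_measurable_continuous_on_Times[OF that] by simp
  have meas_k: "(\<lambda>p. indicator {a<..} (fst p) * k (snd p)) \<in>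
      borel_measurable (borel \<Otimes>\<^sub>M restrict_space borel A)"
    if "continuous_on A k" for a :: real and k :: "'a \<Rightarrow> real"
    using borel_measurable_continuous_on_restrict[OF that] by measurable
  \<comment> \<open>A lower bound for nonnegative functions is enough: applied to
    \<open>f + B\<close> and to \<open>B - f\<close> it gives both halves of the
    convergence.\<close>
  have lower: "\<forall>\<^sub>F u in F. (\<integral>p. f p \<partial>Q) - e < (\<integral>p. f p \<partial>\<nu> u)"
    if f: "continuous_on (UNIV \<times> A) f" and B: "\<And>p. p \<in> UNIV \<times> A \<Longrightarrow> 0 \<le> f p \<and> f p \<le> B"
      and "0 < e" for f :: "real \<times> 'a \<Rightarrow> real" and B e :: real
  proof -
    define m where "m n = real (Suc n)" for n
    have m_pos: "0 < m n" for n by (simp add: m_def)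
    define k where "k n j x = (INF t\<in>{(real_of_int j - 1) / m n .. real_of_int j / m n}. f (t, x))"
      for n j x
    \<comment> \<open>Cells have width \<open>1 / m n\<close>, so indices up to
      \<open>m n * m n\<close> cover the window from \<open>- m n\<close> to \<open>m n\<close>: the
      mesh shrinks while the window exhausts the line.\<close>
    define J where "J n = {\<lceil>- (m n * m n)\<rceil> .. \<lceil>m n * m n\<rceil>}" for n
    define s where "s n p = (\<Sum>j\<in>J n. (indicator {(real_of_int j - 1) / m n<..} (fst p)
      - indicator {real_of_int j / m n<..} (fst p)) * k n j (snd p))" for n p
    have cell_ne: "{(real_of_int j - 1) / m n .. real_of_int j / m n} \<noteq> {}" for j n
      using m_pos[of n] by (simp add: divide_right_mono)
    have cont_k: "continuous_on A (k n j)" for n j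
      unfolding k_def
    proof (rule continuous_on_INF_compact)
      have "continuous_on (A \<times> UNIV) (\<lambda>p. f (snd p, fst p))"
        by (rule continuous_on_compose2[OF f]) (auto intro!: continuous_intros)
      then show "continuous_on (A \<times> {(real_of_int j - 1) / m n .. real_of_int j / m n})
          (\<lambda>(x, t). f (t, x))"
        by (auto simp: case_prod_beta elim: continuous_on_subset)
    qed (use cell_ne in auto)
    have bdd: "bdd_below ((\<lambda>t. f (t, x)) ` C)" if "x \<in> A" for x C
      using B that by (auto intro!: bdd_belowI[of _ 0])
    have k_le: "k n j x \<le> f (t, x)"
      if "x \<in> A" "(real_of_int j - 1) / m n \<le> t" "t \<le> real_of_int j / m n" for n j x t
      unfolding k_def using that by (intro cINF_lower bdd) auto
    have k_nonneg: "0 \<le> k n j x" if "x \<in> A" for n j x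
      unfolding k_def using that B by (intro cINF_greatest cell_ne) auto
    have k_B: "k n j x \<le> B" if "x \<in> A" for n j x
      using k_le[OF that order_refl, of j n] B[of "((real_of_int j - 1) / m n, x)"] that
m_pos[of n]
      by (force simp: divide_right_mono)
    have bnd_k: "bounded (k n j ` A)" for n j
      unfolding bounded_iff using k_nonneg k_B by (intro exI[of _ B]) auto
    \<comment> \<open>The differences of half-line indicators are indicators of disjoint half-open
      cells, and the cell that contains \<open>r\<close> has index
      \<open>\<lceil>m n * r\<rceil>\<close>.\<close>
    have s_eq: "s n (r, x) = (if \<lceil>m n * r\<rceil> \<in> J n then k n \<lceil>m n * r\<rceil> x else 0)" for n r x
    proof -
      have "indicator {(real_of_int j - 1) / m n<..} r - indicator {real_of_int j / m n<..} r
          = (if j = \<lceil>m n * r\<rceil> then 1 else 0 :: real)" for j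
      proof -
        have "j = \<lceil>m n * r\<rceil> \<longleftrightarrow> real_of_int j - 1 < m n * r \<and> m n * r \<le> real_of_int j"
          by (metis ceiling_eq_iff)
        also have "\<dots> \<longleftrightarrow> (real_of_int j - 1) / m n < r \<and> r \<le> real_of_int j / m n"
          using m_pos[of n] by (simp add: field_simps)
        finally have *: "j = \<lceil>m n * r\<rceil> \<longleftrightarrow> \<dots>" .
        have "(real_of_int j - 1) / m n \<le> real_of_int j / m n"
          using m_pos[of n] by (simp add: divide_right_mono)
        then show ?thesis unfolding * by (auto simp: indicator_def)
      qed
      then have "s n (r, x) = (\<Sum>j\<in>J n. if j = \<lceil>m n * r\<rceil> then k n j x else 0)"
        unfolding s_def by (intro sum.cong) (auto)
      then show ?thesis by (simp add: J_def)
    qed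
    have cell: "(real_of_int \<lceil>m n * r\<rceil> - 1) / m n \<le> r" "r \<le> real_of_int \<lceil>m n * r\<rceil> / m n" for n r
      using ceiling_correct[of "m n * r"] m_pos[of n] by (auto simp: field_simps)
    have s_le: "s n p \<le> f p" and s_ge: "0 \<le> s n p" if p_in: "p \<in> UNIV \<times> A" for n p
    proof -
      obtain r x where p: "p = (r, x)" "x \<in> A" using p_in by (cases p) auto
      show "s n p \<le> f p" "0 \<le> s n p"
        using k_le[OF p(2) cell(1) cell(2), of n r] k_nonneg[OF p(2)] B[OF p_in]
        unfolding p(1) s_eq by auto
    qed
    have s_lim: "(\<lambda>n. s n p) \<longlonglongrightarrow> f p" if "p \<in> UNIV \<times> A" for p
    proof (rule LIMSEQ_I)
      fix e :: real assume "0 < e"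
      obtain r x where p: "p = (r, x)" "x \<in> A" using \<open>p \<in> UNIV \<times> A\<close> by (cases p) auto
      have "continuous_on UNIV (\<lambda>t. f (t, x))"
        by (rule continuous_on_compose2[OF f]) (use p in \<open>auto intro!: continuous_intros\<close>)
      then obtain d where "0 < d" and d: "\<And>t. \<bar>t - r\<bar> < d \<Longrightarrow> \<bar>f (t, x) - f (r, x)\<bar> < e / 2"
        using \<open>0 < e\<close> unfolding continuous_on_iff dist_real_def
        by (metis UNIV_I half_gt_zero_iff)
      \<comment> \<open>\<open>N1\<close> makes the cells narrower than \<open>d\<close>, and
        \<open>N2\<close> brings \<open>r\<close> into the window.\<close>
      obtain N1 where N1: "inverse (real (Suc N1)) < d" using reals_Archimedean[OF \<open>0 < d\<close>] by auto
      obtain N2 :: nat where N2: "\<bar>r\<bar> < real N2" using reals_Archimedean2 by blast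
      have "norm (s n p - f p) < e" if n: "max N1 N2 \<le> n" for n
      proof -
        let ?m = "m n" and ?j = "\<lceil>m n * r\<rceil>"
        have "\<bar>?m * r\<bar> \<le> ?m * ?m"
          using N2 n m_pos[of n] by (auto simp: abs_mult m_def intro!: mult_left_mono)
        then have "?j \<in> J n"
          unfolding J_def atLeastAtMost_iff
          by (intro conjI ceiling_mono) (auto simp: abs_le_iff)
        then have s: "s n p = k n ?j x" by (simp add: p s_eq)
        have "inverse ?m < d" 
          by (rule le_less_trans[OF _ N1]) (use n in \<open>simp add: m_def del: of_nat_Suc\<close>)
        have "f (r, x) - e / 2 \<le> k n ?j x"
          unfolding k_def
        proof (rule cINF_greatest[OF cell_ne])
          fix t assume "t \<in> {(real_of_int ?j - 1) / m n .. real_of_int ?j / m n}"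
          then have "\<bar>t - r\<bar> \<le> inverse ?m"
            using cell(1)[of n r] cell(2)[of r n] by (auto simp: diff_divide_distrib inverse_eq_divide abs_le_iff)
          then show "f (r, x) - e / 2 \<le> f (t, x)"
            using d[of t] \<open>inverse ?m < d\<close> by linarith
        qed
        then show ?thesis using s_le[of p n] that s p \<open>0 < e\<close> by auto
      qed
      then show "\<exists>no. \<forall>n\<ge>no. norm (s n p - f p) < e" by blast
    qed
    have s_meas: "s n \<in> borel_measurable (borel \<Otimes>\<^sub>M restrict_space borel A)" for n
      unfolding s_def left_diff_distrib
      by (intro borel_measurable_sum borel_measurable_diff meas_k cont_k)
    have s_int: "(\<integral>p. s n p \<partial>N) = (\<Sum>j\<in>J n.
        (\<integral>p. indicator {(real_of_int j - 1) / m n<..} (fst p) * k n j (snd p) \<partial>N)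
        - (\<integral>p. indicator {real_of_int j / m n<..} (fst p) * k n j (snd p) \<partial>N))"
      if N: "prob_space N" and sets_N: "sets N = sets (borel \<Otimes>\<^sub>M restrict_space borel A)" for n N
    proof -
      interpret N: prob_space N by fact
      have space_N: "space N = UNIV \<times> A"
        by (simp add: sets_eq_imp_space_eq[OF sets_N] space_pair_measure space_restrict_space)
      have "integrable N (\<lambda>p. indicator {a<..} (fst p) * k n j (snd p))" for a j
      proof (rule N.integrable_const_bound[of _ B])
        show "AE p in N. norm (indicator {a<..} (fst p) * k n j (snd p)) \<le> B"
          using k_nonneg k_B order_trans[OF k_nonneg k_B]
          by (intro AE_I2) (auto simp: space_N indicator_def)
        show "(\<lambda>p. indicator {a<..} (fst p) * k n j (snd p)) \<in> borel_measurable N"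
          using meas_k[OF cont_k] by (simp add: measurable_cong_sets[OF sets_N refl])
      qed
      then show ?thesis unfolding s_def left_diff_distrib
        by (simp add: Bochner_Integration.integral_sum)
    qed
    have "(\<lambda>n. \<integral>p. s n p \<partial>Q) \<longlonglongrightarrow> (\<integral>p. f p \<partial>Q)"
    proof (rule integral_dominated_convergence[where w = "\<lambda>_. B"])
      show "AE p in Q. norm (s n p) \<le> B" for n
      proof (rule AE_I2)
        fix p assume "p \<in> space Q"
        then show "norm (s n p) \<le> B"
          using s_le[of p n] s_ge[of p n] B[of p] by (simp add: space_Q)
      qed
    qed (use s_lim meas[OF f] s_meas in \<open>auto simp: space_Q measurable_cong_sets[OF sets_Q refl]\<close>)
    \<comment> \<open>The level \<open>n\<close> is frozen before \<open>u\<close> moves. No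
      uniformity in \<open>n\<close> is required, because \<open>s n \<le> f\<close> holds under
      every \<open>\<nu> u\<close>, and for fixed \<open>n\<close> only finitely many half-line
      integrals have to converge.\<close>
    then have "\<forall>\<^sub>F n in sequentially. (\<integral>p. f p \<partial>Q) - e < (\<integral>p. s n p \<partial>Q)"
      using \<open>0 < e\<close> by (intro order_tendstoD) auto
    then obtain n where n: "(\<integral>p. f p \<partial>Q) - e < (\<integral>p. s n p \<partial>Q)"
      by (auto simp: eventually_sequentially)
    have "((\<lambda>u. \<Sum>j\<in>J n.
        (\<integral>p. indicator {(real_of_int j - 1) / m n<..} (fst p) * k n j (snd p) \<partial>\<nu> u)
        - (\<integral>p. indicator {real_of_int j / m n<..} (fst p) * k n j (snd p) \<partial>\<nu> u))
        \<longlongrightarrow> (\<integral>p. s n p \<partial>Q)) F"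
      unfolding s_int[OF Q sets_Q] by (rule tendsto_sum, rule tendsto_diff; rule conv[OF cont_k bnd_k])
    then have "\<forall>\<^sub>F u in F. (\<integral>p. f p \<partial>Q) - e < (\<Sum>j\<in>J n.
        (\<integral>p. indicator {(real_of_int j - 1) / m n<..} (fst p) * k n j (snd p) \<partial>\<nu> u)
        - (\<integral>p. indicator {real_of_int j / m n<..} (fst p) * k n j (snd p) \<partial>\<nu> u))"
      using n by (rule order_tendstoD)
    with \<nu> show ?thesis
    proof eventually_elim
      case (elim u)
      interpret \<nu>: prob_space "\<nu> u" by (fact elim)
      have int: "integrable (\<nu> u) g"
        if "g \<in> borel_measurable (borel \<Otimes>\<^sub>M restrict_space borel A)"
          "\<And>p. p \<in> UNIV \<times> A \<Longrightarrow> 0 \<le> g p \<and> g p \<le> B" for g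
        using that by (intro \<nu>.integrable_const_bound[of _ B] AE_I2)
          (auto simp: space_\<nu> measurable_cong_sets[OF sets_\<nu> refl])
      have "(\<integral>p. s n p \<partial>\<nu> u) \<le> (\<integral>p. f p \<partial>\<nu> u)"
      proof (rule integral_mono)
        show "integrable (\<nu> u) (s n)"
          by (intro int s_meas conjI s_ge order_trans[OF s_le conjunct2[OF B]])
        show "integrable (\<nu> u) f" by (intro int meas f B)
      qed (use s_le in \<open>auto simp: space_\<nu>\<close>)
      then show ?case using elim(2) s_int[OF elim(1) sets_\<nu>, of n] by simp
    qed
  qed
  show ?thesis unfolding weak_tendsto_def
  proof (intro allI impI, elim conjE)
    fix f :: "real \<times> 'a \<Rightarrow> real"
    assume f: "continuous_on (UNIV \<times> A) f" and "bounded (f ` (UNIV \<times> A))"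
    then obtain B where B: "\<And>p. p \<in> UNIV \<times> A \<Longrightarrow> \<bar>f p\<bar> \<le> B"
      by (auto simp: bounded_iff)
    have int: "(\<integral>p. f p + B \<partial>N) = (\<integral>p. f p \<partial>N) + B" "(\<integral>p. B - f p \<partial>N) = B - (\<integral>p. f p \<partial>N)"
      if N: "prob_space N" and sets_N: "sets N = sets (borel \<Otimes>\<^sub>M restrict_space borel A)" for N
    proof -
      interpret N: prob_space N by fact
      have space_N: "space N = UNIV \<times> A"
        by (simp add: sets_eq_imp_space_eq[OF sets_N] space_pair_measure space_restrict_space)
      have "integrable N f"
        by (rule N.integrable_const_bound[of _ B])
          (use B meas[OF f] in \<open>auto simp: space_N measurable_cong_sets[OF sets_N refl]\<close>)
      then show "(\<integral>p. f p + B \<partial>N) = (\<integral>p. f p \<partial>N) + B" "(\<integral>p. B - f p \<partial>N) = B - (\<integral>p. f p \<partial>N)"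
        by (simp_all add: N.prob_space)
    qed
    have lo: "\<forall>\<^sub>F u in F. (\<integral>p. f p + B \<partial>Q) - e < (\<integral>p. f p + B \<partial>\<nu> u)" if "0 < e" for e
    proof (rule lower[of "\<lambda>p. f p + B" "2 * B"])
      show "0 \<le> f p + B \<and> f p + B \<le> 2 * B" if "p \<in> UNIV \<times> A" for p
        using B[OF that] by (auto simp: abs_le_iff)
    qed (intro continuous_intros f, fact)
    have up: "\<forall>\<^sub>F u in F. (\<integral>p. B - f p \<partial>Q) - e < (\<integral>p. B - f p \<partial>\<nu> u)" if "0 < e" for e
    proof (rule lower[of "\<lambda>p. B - f p" "2 * B"])
      show "0 \<le> B - f p \<and> B - f p \<le> 2 * B" if "p \<in> UNIV \<times> A" for p
        using B[OF that] by (auto simp: abs_le_iff)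
    qed (intro continuous_intros f, fact)
    show "((\<lambda>u. \<integral>p. f p \<partial>\<nu> u) \<longlongrightarrow> (\<integral>p. f p \<partial>Q)) F"
    proof (rule tendstoI)
      fix e :: real assume "0 < e"
      from \<nu> up[OF this] lo[OF this] show "\<forall>\<^sub>F u in F. dist (\<integral>p. f p \<partial>\<nu> u) (\<integral>p. f p \<partial>Q) < e"
        by eventually_elim (auto simp: int[OF _ sets_\<nu>] int[OF Q sets_Q] dist_real_def)
    qed
  qed
qed

section \<open>The Pareto law and the radial measure\<close>

abbreviation (input) radial :: "real \<Rightarrow> real measure" where
  "radial \<alpha> \<equiv> density (restrict_space lborel {0<..}) (\<lambda>r. ennreal (\<alpha> * r powr (- \<alpha> - 1)))"

lemma sets_radial: "sets (radial \<alpha>) = sets (restrict_space borel {0<..})"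
  by (simp add: sets_restrict_space)

lemma emeasure_radial:
  assumes "0 < \<alpha>" "0 < a"
  shows "emeasure (radial \<alpha>) {a<..} = ennreal (a powr - \<alpha>)"
proof -
  have "emeasure (radial \<alpha>) {a<..} =
      (\<integral>\<^sup>+x. ennreal (\<alpha> * x powr (- \<alpha> - 1)) * indicator {a<..} x \<partial>restrict_space lborel {0<..})"
    using \<open>0 < a\<close> by (intro emeasure_density)
      (auto simp: sets_restrict_space measurable_restrict_space1 intro!: image_eqI[of _ _ "{a<..}"])
  also have "\<dots> = (\<integral>\<^sup>+x. ennreal (\<alpha> * x powr (- \<alpha> - 1)) * indicator {a<..} x * indicator {0<..} x \<partial>lborel)"
    by (intro nn_integral_restrict_space) auto
  \<comment> \<open>The fundamental theorem of calculus is applied on the closed half-line, which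
    differs from the open one by a null set.\<close>
  also have "\<dots> = (\<integral>\<^sup>+x. ennreal (\<alpha> * x powr (- \<alpha> - 1)) * indicator {a..} x \<partial>lborel)"
  proof (rule nn_integral_cong_AE)
    show "AE x in lborel. ennreal (\<alpha> * x powr (- \<alpha> - 1)) * indicator {a<..} x * indicator {0<..} x =
        ennreal (\<alpha> * x powr (- \<alpha> - 1)) * indicator {a..} x"
      using AE_lborel_singleton[of a]
      by eventually_elim (use \<open>0 < a\<close> in \<open>auto simp: indicator_def\<close>)
  qed
  also have "\<dots> = ennreal (0 - - (a powr - \<alpha>))"
  proof (rule nn_integral_FTC_atLeast)
    show "((\<lambda>x. - (x powr - \<alpha>)) has_real_derivative \<alpha> * x powr (- \<alpha> - 1)) (at x)" if "a \<le> x" for x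
      using that \<open>0 < a\<close> by (auto intro!: derivative_eq_intros)
    have "((\<lambda>x. - (x powr - \<alpha>)) \<longlongrightarrow> - 0) at_top"
      using \<open>0 < \<alpha>\<close> by (intro tendsto_intros tendsto_neg_powr filterlim_ident) auto
    then show "((\<lambda>x. - (x powr - \<alpha>)) \<longlongrightarrow> 0) at_top" by simp
  qed (use assms in auto)
  finally show ?thesis by simp
qed

text \<open>Needed for products and Fubini: the radial measure has infinite mass near zero.\<close>

lemma sigma_finite_radial: "sigma_finite_measure (radial \<alpha>)"
proof -
  interpret sigma_finite_measure "restrict_space lborel {0<..} :: real measure"
    by (rule sigma_finite_measure_restrict_space) (auto simp: lborel.sigma_finite_measure_axioms)
  show ?thesis
    by (subst sigma_finite_iff_density_finite) (auto simp: measurable_restrict_space1)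
qed

lemma real_distribution_eqI_greaterThan:
  assumes "real_distribution N1" "real_distribution N2"
    and "\<And>y. measure N1 {y<..} = measure N2 {y<..}"
  shows "N1 = N2"
proof -
  interpret N1: real_distribution N1 by fact
  interpret N2: real_distribution N2 by fact
  have "cdf N1 y = cdf N2 y" for y
  proof -
    have "{y<..} = UNIV - {..y}" by auto
    then show ?thesis
      using assms(3)[of y] N1.prob_compl[of "{..y}"] N2.prob_compl[of "{..y}"]
      by (simp add: cdf_def)
  qed
  then show ?thesis
    by (intro cdf_unique assms ext) (auto intro: assms)
qed

text \<open>All the mass lies beyond 1, so lower thresholds act like 1. The \<open>max\<close>
  matches the one in \<open>integral_polar_law_half_line\<close>.\<close>

lemma measure_pareto_greaterThan:
  assumes "0 < \<alpha>"
  shows "measure (pareto \<alpha>) {y<..} = max 1 y powr - \<alpha>"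
proof (cases "1 \<le> y")
  case True
  then show ?thesis using measure_pareto[OF assms] by (simp add: max_def)
next
  case False
  interpret real_distribution "pareto \<alpha>" using assms by (rule real_distribution_pareto)
  have "measure (pareto \<alpha>) {1<..} \<le> measure (pareto \<alpha>) {y<..}"
    using False by (intro finite_measure_mono) auto
  then have "measure (pareto \<alpha>) {y<..} = 1"
    using measure_pareto[OF assms, of 1] prob_le_1[of "{y<..}"] by simp
  then show ?thesis using False by (simp add: max_def)
qed

text \<open>The radial measure on \<open>(c, \<infinity>)\<close>, normalised to mass one, is the law of \<open>c\<close> times a Pareto
  variable.\<close>

lemma integral_radial_eq_pareto:
  fixes f :: "real \<Rightarrow> real"
  assumes "0 < \<alpha>" "0 < c" and f: "f \<in> borel_measurable borel"
  shows "(\<integral>r. indicator {c<..} r * f (r / c) \<partial>radial \<alpha>) = c powr - \<alpha> * (\<integral>r. f r \<partial>pareto \<alpha>)"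
proof -
  interpret P: real_distribution "pareto \<alpha>" using assms(1) by (rule real_distribution_pareto)
  \<comment> \<open>The factor \<open>c powr \<alpha>\<close> is the reciprocal of the radial mass
    of \<open>{c<..}\<close>. The weighted measure \<open>D\<close> is thus a probability measure on
    radii above \<open>c\<close>, and division by \<open>c\<close> carries it to the Pareto law, as
    the tails show.\<close>
  let ?w = "\<lambda>r. ennreal (c powr \<alpha> * indicator {c<..} r)"
  define D where "D = density (radial \<alpha>) ?w"
  define N where "N = distr D borel (\<lambda>r. r / c)"
  have sets_D: "sets D = sets (restrict_space borel {0<..})"
    by (simp add: D_def sets_restrict_space)
  have w: "?w \<in> borel_measurable (radial \<alpha>)"
    by (simp add: measurable_restrict_space1)
  have div_meas: "(\<lambda>r. r / c) \<in> measurable D borel"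
    by (simp add: measurable_cong_sets[OF sets_D refl] measurable_restrict_space1)
  have D: "emeasure D {y<..} = ennreal (max 1 (y / c) powr - \<alpha>)" if "0 \<le> y" for y
  proof -
    have "{y<..} \<in> sets (radial \<alpha>)"
      using that unfolding sets_radial by (auto simp: sets_restrict_space intro!: image_eqI[of _ _ "{y<..}"])
    then have "emeasure D {y<..} = (\<integral>\<^sup>+r. ?w r * indicator {y<..} r \<partial>radial \<alpha>)"
      unfolding D_def by (intro emeasure_density w)
    also have "\<dots> = (\<integral>\<^sup>+r. ennreal (c powr \<alpha>) * indicator {max c y<..} r \<partial>radial \<alpha>)"
      by (intro nn_integral_cong) (auto simp: indicator_def)
    also have "\<dots> = ennreal (c powr \<alpha>) * emeasure (radial \<alpha>) {max c y<..}"
      using \<open>0 < c\<close> unfolding sets_radial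
      by (intro nn_integral_cmult_indicator)
        (auto simp: sets_restrict_space intro!: image_eqI[of _ _ "{max c y<..}"])
    also have "\<dots> = ennreal (c powr \<alpha> * max c y powr - \<alpha>)"
      using assms by (subst emeasure_radial) (auto simp: ennreal_mult)
    also have "c powr \<alpha> * max c y powr - \<alpha> = max 1 (y / c) powr - \<alpha>"
    proof -
      have "max c y = c * max 1 (y / c)"
        using \<open>0 < c\<close> by (simp add: max_mult_distrib_left)
      then show ?thesis
        using \<open>0 < c\<close> by (simp add: powr_mult powr_minus)
    qed
    finally show ?thesis .
  qed
  have N: "emeasure N {y<..} = ennreal (max 1 y powr - \<alpha>)" for y
  proof -
    have "emeasure N {y<..} = emeasure D ((\<lambda>r. r / c) -` {y<..} \<inter> space D)"
      unfolding N_def by (rule emeasure_distr[OF div_meas]) auto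
    also have "(\<lambda>r. r / c) -` {y<..} \<inter> space D = {max 0 (c * y)<..}"
      using \<open>0 < c\<close> by (auto simp: sets_eq_imp_space_eq[OF sets_D] space_restrict_space field_simps)
    also have "emeasure D \<dots> = ennreal (max 1 y powr - \<alpha>)"
    proof -
      have "max 1 (max 0 (c * y) / c) = max 1 y"
        using \<open>0 < c\<close> by (auto simp: max_def zero_le_mult_iff mult_le_0_iff)
      then show ?thesis by (subst D) auto
    qed
    finally show ?thesis .
  qed
  have "space D = {0<..}"
    by (simp add: sets_eq_imp_space_eq[OF sets_D] space_restrict_space)
  then have "prob_space D" using D[of 0] by (intro prob_spaceI) simp
  then have rd: "real_distribution N"
    unfolding N_def real_distribution_def real_distribution_axioms_def
    using prob_space.prob_space_distr[OF _ div_meas] by simp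
  have "N = pareto \<alpha>"
    using N assms(1)
    by (intro real_distribution_eqI_greaterThan rd P.real_distribution_axioms)
      (simp add: measure_def[of N] measure_pareto_greaterThan)
  then have "(\<integral>r. f r \<partial>pareto \<alpha>) = (\<integral>r. f (r / c) \<partial>D)"
    unfolding N_def using integral_distr[OF div_meas f] by simp
  also have "\<dots> = (\<integral>r. c powr \<alpha> * indicator {c<..} r * f (r / c) \<partial>radial \<alpha>)"
    unfolding D_def using w f
    by (subst integral_density) (auto simp: measurable_restrict_space1)
  also have "\<dots> = c powr \<alpha> * (\<integral>r. indicator {c<..} r * f (r / c) \<partial>radial \<alpha>)"
    by (simp add: mult.assoc)
  finally show ?thesis using \<open>0 < c\<close> by (simp add: powr_minus)
qed

lemma integral_pair_indicator_mult:
  fixes k :: "'a \<Rightarrow> real"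
  assumes "prob_space P" "prob_space H" "B \<in> sets P" and k: "k \<in> borel_measurable H"
    "\<And>x. x \<in> space H \<Longrightarrow> \<bar>k x\<bar> \<le> K"
  shows "(\<integral>p. indicator B (fst p) * k (snd p) \<partial>(P \<Otimes>\<^sub>M H)) = measure P B * (\<integral>x. k x \<partial>H)"
proof -
  interpret P: prob_space P by fact
  interpret H: prob_space H by fact
  interpret PH: pair_prob_space P H ..
  have "integrable (P \<Otimes>\<^sub>M H) (\<lambda>p. indicator B (fst p) * k (snd p))"
  proof (rule PH.integrable_const_bound[of _ K], rule AE_I2)
    fix p assume "p \<in> space (P \<Otimes>\<^sub>M H)"
    then have "\<bar>k (snd p)\<bar> \<le> K" by (intro k(2)) (auto simp: space_pair_measure)
    then show "norm (indicator B (fst p) * k (snd p)) \<le> K"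
      by (auto simp: indicator_def)
  next
    show "(\<lambda>p. indicator B (fst p) * k (snd p)) \<in> borel_measurable (P \<Otimes>\<^sub>M H)"
      using k(1) \<open>B \<in> sets P\<close> by measurable
  qed
  from PH.integral_fst'[OF this]
  have "(\<integral>p. indicator B (fst p) * k (snd p) \<partial>(P \<Otimes>\<^sub>M H)) =
      (\<integral>r. indicator B r * (\<integral>x. k x \<partial>H) \<partial>P)" by simp
  also have "\<dots> = measure P B * (\<integral>x. k x \<partial>H)"
    using \<open>B \<in> sets P\<close> sets.sets_into_space[OF \<open>B \<in> sets P\<close>]
    by (simp add: Int_absorb2)
  finally show ?thesis .
qed

text \<open>Integrating the radius first, at a fixed angle, reduces this to
  \<open>integral_radial_eq_pareto\<close>. Fubini applies because \<open>G\<close> is bounded and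
  the indicator confines the integrand to \<open>{c<..} \<times> space H\<close>, which has finite
  mass although the whole product does not.\<close>

lemma integral_radial_pair_eq_pareto:
  fixes G :: "real \<times> 'a \<Rightarrow> real"
  assumes "0 < \<alpha>" "0 < c" "prob_space H" and G: "G \<in> borel_measurable (borel \<Otimes>\<^sub>M H)"
    and B: "\<And>p. p \<in> UNIV \<times> space H \<Longrightarrow> \<bar>G p\<bar> \<le> B"
  shows "(\<integral>p. indicator {c<..} (fst p) * G (fst p / c, snd p) \<partial>(radial \<alpha> \<Otimes>\<^sub>M H)) =
    c powr - \<alpha> * (\<integral>p. G p \<partial>(pareto \<alpha> \<Otimes>\<^sub>M H))"
proof -
  interpret P: real_distribution "pareto \<alpha>" using assms(1) by (rule real_distribution_pareto)
  interpret R: sigma_finite_measure "radial \<alpha>" by (rule sigma_finite_radial)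
  interpret H: prob_space H by fact
  interpret PH: pair_prob_space "pareto \<alpha>" H ..
  interpret RH: pair_sigma_finite "radial \<alpha>" H ..
  have tail: "{c<..} \<in> sets (radial \<alpha>)"
    using \<open>0 < c\<close> unfolding sets_radial
    by (auto simp: sets_restrict_space intro!: image_eqI[of _ _ "{c<..}"])
  have id: "(\<lambda>r. r) \<in> measurable (radial \<alpha>) borel"
    by (simp add: measurable_restrict_space1)
  have fst_meas: "fst \<in> measurable (radial \<alpha> \<Otimes>\<^sub>M H) borel"
    by (rule measurable_compose[OF measurable_fst id])
  then have "(\<lambda>p. (fst p / c, snd p)) \<in> measurable (radial \<alpha> \<Otimes>\<^sub>M H) (borel \<Otimes>\<^sub>M H)"
    by (intro measurable_Pair borel_measurable_divide measurable_snd) auto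
  from measurable_compose[OF this G] fst_meas
  have meas: "(\<lambda>p. indicator {c<..} (fst p) * G (fst p / c, snd p)) \<in> borel_measurable (radial \<alpha> \<Otimes>\<^sub>M H)"
    by (auto intro!: borel_measurable_times measurable_compose[OF fst_meas])
  have "integrable (radial \<alpha> \<Otimes>\<^sub>M H) (\<lambda>p. indicator {c<..} (fst p) * G (fst p / c, snd p))"
    (is "integrable _ ?F")
  proof (rule integrableI_bounded_set[where A = "{c<..} \<times> space H" and B = B])
    show "emeasure (radial \<alpha> \<Otimes>\<^sub>M H) ({c<..} \<times> space H) < \<infinity>"
      using tail assms by (subst H.emeasure_pair_measure_Times) (auto simp: emeasure_radial H.emeasure_space_1)
    show "AE p in radial \<alpha> \<Otimes>\<^sub>M H. p \<in> {c<..} \<times> space H \<longrightarrow>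
        norm (indicator {c<..} (fst p) * G (fst p / c, snd p)) \<le> B"
    proof (intro AE_I2 impI)
      fix p assume "p \<in> {c<..} \<times> space H"
      then have "\<bar>G (fst p / c, snd p)\<bar> \<le> B" by (intro B) auto
      then show "norm (indicator {c<..} (fst p) * G (fst p / c, snd p)) \<le> B"
        by (auto simp: indicator_def)
    qed
    show "AE p in radial \<alpha> \<Otimes>\<^sub>M H. p \<notin> {c<..} \<times> space H \<longrightarrow>
        indicator {c<..} (fst p) * G (fst p / c, snd p) = 0"
      by (intro AE_I2) (auto simp: indicator_def space_pair_measure)
    show "{c<..} \<times> space H \<in> sets (radial \<alpha> \<Otimes>\<^sub>M H)"
      using tail by (intro pair_measureI) auto
  qed (rule meas)
  then have "(\<integral>p. indicator {c<..} (fst p) * G (fst p / c, snd p) \<partial>(radial \<alpha> \<Otimes>\<^sub>M H)) =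
      (\<integral>x. (\<integral>r. indicator {c<..} r * G (r / c, x) \<partial>radial \<alpha>) \<partial>H)"
    using RH.integral_snd[of "\<lambda>r x. ?F (r, x)"] by (simp add: case_prod_unfold)
  also have "\<dots> = (\<integral>x. c powr - \<alpha> * (\<integral>r. G (r, x) \<partial>pareto \<alpha>) \<partial>H)"
  proof (rule Bochner_Integration.integral_cong[OF refl])
    fix x assume "x \<in> space H"
    then have "(\<lambda>r. G (r, x)) \<in> borel_measurable borel"
      by (intro measurable_compose[OF measurable_Pair2' G])
    then show "(\<integral>r. indicator {c<..} r * G (r / c, x) \<partial>radial \<alpha>) =
        c powr - \<alpha> * (\<integral>r. G (r, x) \<partial>pareto \<alpha>)"
      by (rule integral_radial_eq_pareto[OF assms(1,2)])
  qed
  also have "\<dots> = c powr - \<alpha> * (\<integral>p. G p \<partial>(pareto \<alpha> \<Otimes>\<^sub>M H))"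
  proof -
    have "integrable (pareto \<alpha> \<Otimes>\<^sub>M H) G"
    proof (rule PH.integrable_const_bound[of _ B], rule AE_I2)
      show "norm (G p) \<le> B" if "p \<in> space (pareto \<alpha> \<Otimes>\<^sub>M H)" for p
        using B[of p] that by (simp add: space_pair_measure)
    next
      have "sets (pareto \<alpha> \<Otimes>\<^sub>M H) = sets (borel \<Otimes>\<^sub>M H)"
        by (intro sets_pair_measure_cong) auto
      from measurable_cong_sets[OF this refl] G
      show "G \<in> borel_measurable (pareto \<alpha> \<Otimes>\<^sub>M H)" by simp
    qed
    then show ?thesis using PH.integral_snd[of "\<lambda>r x. G (r, x)"] by simp
  qed
  finally show ?thesis .
qed

section \<open>Polar coordinates\<close>

lemma prob_on_D:
  assumes "prob_on A H"
  shows "sets H = sets (restrict_space borel A)" "prob_space H" "space H = A"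
proof -
  show sets: "sets H = sets (restrict_space borel A)" and "prob_space H"
    using assms by (auto simp: prob_on_def)
  show "space H = A"
    by (simp add: sets_eq_imp_space_eq[OF sets] space_restrict_space)
qed

locale polar_space =
  fixes z :: "'a::polish_space" and smul :: "real \<Rightarrow> 'a \<Rightarrow> 'a" and \<rho> :: "'a \<Rightarrow> real"
  assumes scalar_mult: "scalar_mult z smul" and modulus: "modulus z smul \<rho>"
begin

abbreviation "S1 \<equiv> restrict_space borel (unit_sphere \<rho>)"
abbreviation "\<theta> \<equiv> angle smul \<rho>"

lemma smul_smul: "0 \<le> l1 \<Longrightarrow> 0 \<le> l2 \<Longrightarrow> smul l1 (smul l2 x) = smul (l1 * l2) x"
  and smul_1: "smul 1 x = x"
  using scalar_mult by (auto simp: scalar_mult_def)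

lemma continuous_on_smul [continuous_intros]:
  assumes "continuous_on S f" "continuous_on S g" "\<And>x. x \<in> S \<Longrightarrow> 0 \<le> f x"
  shows "continuous_on S (\<lambda>x. smul (f x) (g x))"
proof -
  have "continuous_on ({0..} \<times> UNIV) (\<lambda>(l, x). smul l x)"
    using scalar_mult by (simp add: scalar_mult_def)
  from continuous_on_compose2[OF this continuous_on_Pair[OF assms(1,2)]] assms(3)
  show ?thesis by auto
qed

lemma modulus_nonneg: "0 \<le> \<rho> x"
  and modulus_smul: "0 \<le> l \<Longrightarrow> \<rho> (smul l x) = l * \<rho> x"
  using modulus by (auto simp: modulus_def)

lemma continuous_on_modulus [continuous_intros]:
  "continuous_on S f \<Longrightarrow> continuous_on S (\<lambda>x. \<rho> (f x))"
  using modulus by (auto simp: modulus_def intro: continuous_on_compose2)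

lemma borel_measurable_modulus [measurable]: "\<rho> \<in> borel_measurable borel"
  by (intro borel_measurable_continuous_onI continuous_intros)

text \<open>The infimum condition on a modulus in usable form: any positive real \<open>c\<close>
  below the infimum works. Such a \<open>c\<close> is taken by density since the infimum itself may
  be infinite. Continuity of \<open>\<rho>\<close> supplies the converse comparison, so that
  \<open>\<rho>\<close> and the distance define the same neighbourhoods of the origin.\<close>

lemma dist_origin_le_of_modulus_less:
  assumes "0 < e"
  obtains c where "0 < c" "\<And>x. \<rho> x < c \<Longrightarrow> dist x z \<le> e"
proof -
  let ?I = "INF x\<in>{x. e < dist x z}. ennreal (\<rho> x)"
  have "0 < ?I" using modulus assms by (auto simp: modulus_def)
  then obtain c where c: "0 < c" "ennreal c < ?I"
    using dense[of 0 ?I] by (metis ennreal_cases ennreal_less_zero_iff not_less_iff_gr_or_eq top.not_eq_extremum less_top)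
  have "dist x z \<le> e" if "\<rho> x < c" for x
  proof (rule ccontr)
    assume "\<not> dist x z \<le> e"
    then have "?I \<le> ennreal (\<rho> x)" by (intro INF_lower) auto
    with c(2) have "ennreal c < ennreal (\<rho> x)" by (rule less_le_trans)
    then show False using that c by (simp add: ennreal_less_iff)
  qed
  with c that show ?thesis by blast
qed

lemma modulus_eq_0_iff: "\<rho> x = 0 \<longleftrightarrow> x = z"
proof -
  have imp: "x = z" if "\<rho> x = 0" for x
  proof (rule ccontr)
    assume "x \<noteq> z"
    then obtain c where "0 < c" "\<And>y. \<rho> y < c \<Longrightarrow> dist y z \<le> dist x z / 2"
      using dist_origin_le_of_modulus_less[of "dist x z / 2"] by auto
    from this(2)[of x] \<open>0 < c\<close> \<open>x \<noteq> z\<close> that show False by simp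
  qed
  \<comment> \<open>Homogeneity with factor zero exhibits a zero of \<open>\<rho>\<close>. By the
    implication just proved this zero is \<open>z\<close> itself, whence
    \<open>\<rho> z = 0\<close>.\<close>
  have "\<rho> (smul 0 z) = 0" by (simp add: modulus_smul)
  with imp[OF this] imp show ?thesis by metis
qed

lemma modulus_pos_iff: "0 < \<rho> x \<longleftrightarrow> x \<noteq> z"
  using modulus_nonneg[of x] modulus_eq_0_iff[of x] by linarith

lemma smul_eq_origin_iff: "0 < l \<Longrightarrow> smul l x = z \<longleftrightarrow> x = z"
  by (simp add: modulus_smul flip: modulus_eq_0_iff)

lemma angle_in_unit_sphere: "x \<noteq> z \<Longrightarrow> \<theta> x \<in> unit_sphere \<rho>"
  using modulus_pos_iff[of x] by (simp add: angle_def unit_sphere_def modulus_smul)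

text \<open>The factor \<open>l\<close> cancels against its inverse. This also covers the origin,
  where \<open>inverse 0 = 0\<close> makes both sides \<open>smul 0 x\<close>.\<close>

lemma angle_smul: "0 < l \<Longrightarrow> \<theta> (smul l x) = \<theta> x"
  using modulus_nonneg[of x] by (simp add: angle_def modulus_smul smul_smul mult.commute[of _ l] flip: mult.assoc)

lemma smul_angle: "x \<noteq> z \<Longrightarrow> smul (\<rho> x) (\<theta> x) = x"
  using modulus_pos_iff[of x] by (simp add: angle_def smul_smul smul_1)

lemma angle_unit_sphere: "x \<in> unit_sphere \<rho> \<Longrightarrow> \<theta> x = x"
  by (simp add: angle_def unit_sphere_def smul_1)

lemma modulus_smul_unit_sphere: "0 \<le> r \<Longrightarrow> x \<in> unit_sphere \<rho> \<Longrightarrow> \<rho> (smul r x) = r"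
  by (simp add: modulus_smul unit_sphere_def)

lemma smul_unit_sphere_neq: "0 < r \<Longrightarrow> x \<in> unit_sphere \<rho> \<Longrightarrow> smul r x \<noteq> z"
  using modulus_smul_unit_sphere[of r x] by (auto simp flip: modulus_pos_iff)

lemma continuous_on_angle: "continuous_on (- {z}) \<theta>"
  unfolding angle_def[abs_def]
  by (intro continuous_intros) (auto simp: modulus_eq_0_iff modulus_nonneg)

lemma measurable_angle: "\<theta> \<in> measurable (restrict_space borel (- {z})) S1"
  using borel_measurable_continuous_on_restrict[OF continuous_on_angle]
  by (intro measurable_restrict_space2) (auto simp: space_restrict_space angle_in_unit_sphere)

lemma measurable_polar:
  "(\<lambda>x. (\<rho> x, \<theta> x)) \<in> measurable (restrict_space borel (- {z})) (restrict_space borel {0<..} \<Otimes>\<^sub>M S1)"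
proof (rule measurable_Pair[OF _ measurable_angle])
  show "\<rho> \<in> measurable (restrict_space borel (- {z})) (restrict_space borel {0<..})"
    by (intro measurable_restrict_space2 measurable_restrict_space1)
      (auto simp: space_restrict_space modulus_pos_iff)
qed

lemma measurable_smul:
  "(\<lambda>(r, x). smul r x) \<in> measurable (restrict_space borel {0<..} \<Otimes>\<^sub>M S1) (restrict_space borel (- {z}))"
proof (rule measurable_restrict_space2)
  show "(\<lambda>(r, x). smul r x) \<in> measurable (restrict_space borel {0<..} \<Otimes>\<^sub>M S1) borel"
    unfolding case_prod_beta
    by (intro borel_measurable_continuous_on_Times continuous_intros) auto
qed (auto simp: space_pair_measure space_restrict_space dest: smul_unit_sphere_neq)

lemma sets_modulus_greater:
  assumes "0 \<le> c"
  shows "{x. c < \<rho> x} \<in> sets (restrict_space borel (- {z}))"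
proof -
  have "{x \<in> space borel. c < \<rho> x} \<in> sets borel" by measurable
  moreover have "{x. c < \<rho> x} \<subseteq> - {z}"
    using assms modulus_eq_0_iff[of z] by auto
  ultimately show ?thesis by (subst sets_restrict_space_iff) auto
qed

text \<open>The set \<open>{x. \<rho> x < c}\<close> is open and contains the origin, hence a ball
  around it, so vanishing for small modulus is an admissible form of vanishing near the
  origin.\<close>

lemma M0_tendsto_integral:
  fixes f :: "'a \<Rightarrow> real"
  assumes "M0_tendsto z \<mu>s \<mu> F" "continuous_on (- {z}) f" "bounded (f ` (- {z}))"
    and "0 < c" "\<And>x. \<rho> x < c \<Longrightarrow> f x = 0"
  shows "((\<lambda>u. \<integral>x. f x \<partial>\<mu>s u) \<longlongrightarrow> (\<integral>x. f x \<partial>\<mu>)) F"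
proof -
  have "open {x. \<rho> x < c}" by (intro open_Collect_less continuous_intros)
  moreover have "\<rho> z = 0" by (simp add: modulus_eq_0_iff)
  ultimately obtain r where "0 < r" "ball z r \<subseteq> {x. \<rho> x < c}"
    using \<open>0 < c\<close> by (metis mem_Collect_eq open_contains_ball)
  then have "\<forall>x. x \<noteq> z \<longrightarrow> dist x z < r \<longrightarrow> f x = 0"
    using assms(5) by (force simp: dist_commute)
  with \<open>0 < r\<close> assms(1-3) show ?thesis unfolding M0_tendsto_def by blast
qed

lemma emeasure_M0_finite:
  assumes "\<mu> \<in> M0 z" "0 < c"
  shows "emeasure \<mu> {x. c < \<rho> x} < \<infinity>"
proof -
  have z: "\<rho> z < c" using assms(2) modulus_eq_0_iff[of z] by simp
  have "open {x. \<rho> x < c}" by (intro open_Collect_less continuous_intros)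
  with z have "emeasure \<mu> (- {x. \<rho> x < c}) < \<infinity>" using assms(1) unfolding M0_def by blast
  moreover have "- {x. \<rho> x < c} \<in> sets \<mu>"
  proof -
    have "- {x. \<rho> x < c} \<in> sets borel"
      using \<open>open {x. \<rho> x < c}\<close> by (intro borel_comp borel_open)
    moreover have "sets \<mu> = sets (restrict_space borel (- {z}))" using assms(1) by (simp add: M0_def)
    ultimately show ?thesis using z by (auto simp: sets_restrict_space_iff)
  qed
  then have "emeasure \<mu> {x. c < \<rho> x} \<le> emeasure \<mu> (- {x. \<rho> x < c})"
    by (intro emeasure_mono) auto
  ultimately show ?thesis by (rule le_less_trans[rotated])
qed

section \<open>The measure with a prescribed polar form\<close>

definition polar_measure :: "real \<Rightarrow> 'a measure \<Rightarrow> 'a measure" where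
  "polar_measure \<alpha> H = distr (radial \<alpha> \<Otimes>\<^sub>M H) (restrict_space borel (- {z})) (\<lambda>(r, x). smul r x)"

abbreviation has_polar_form :: "real \<Rightarrow> 'a measure \<Rightarrow> 'a measure \<Rightarrow> bool" where
  "has_polar_form \<alpha> \<mu> H \<equiv>
    distr \<mu> (restrict_space borel {0<..} \<Otimes>\<^sub>M S1) (\<lambda>x. (\<rho> x, \<theta> x)) = radial \<alpha> \<Otimes>\<^sub>M H"

context
  fixes \<alpha> :: real and H :: "'a measure"
  assumes \<alpha>: "0 < \<alpha>" and H: "prob_on (unit_sphere \<rho>) H"
begin

lemmas sets_H = prob_on_D(1)[OF H] and prob_H = prob_on_D(2)[OF H] and space_H = prob_on_D(3)[OF H]

lemma sets_radial_pair: "sets (radial \<alpha> \<Otimes>\<^sub>M H) = sets (restrict_space borel {0<..} \<Otimes>\<^sub>M S1)"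
  by (intro sets_pair_measure_cong sets_radial sets_H)

lemma measurable_smul_radial:
  "(\<lambda>(r, x). smul r x) \<in> measurable (radial \<alpha> \<Otimes>\<^sub>M H) (restrict_space borel (- {z}))"
  using measurable_smul by (simp only: measurable_cong_sets[OF sets_radial_pair refl])

lemma sets_polar_measure: "sets (polar_measure \<alpha> H) = sets (restrict_space borel (- {z}))"
  by (simp add: polar_measure_def)

text \<open>The measure is the image of the product under the inverse of the polar map, so composing
  the two maps gives the identity on positive radii and unit vectors.\<close>

lemma polar_form_polar_measure: "has_polar_form \<alpha> (polar_measure \<alpha> H) H"
proof -
  have "has_polar_form \<alpha> (polar_measure \<alpha> H) H \<longleftrightarrow>
      distr (radial \<alpha> \<Otimes>\<^sub>M H) (restrict_space borel {0<..} \<Otimes>\<^sub>M S1)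
        ((\<lambda>x. (\<rho> x, \<theta> x)) \<circ> (\<lambda>(r, x). smul r x)) = radial \<alpha> \<Otimes>\<^sub>M H"
    unfolding polar_measure_def
    by (subst distr_distr[OF measurable_polar measurable_smul_radial]) (rule refl)
  also have "distr (radial \<alpha> \<Otimes>\<^sub>M H) (restrict_space borel {0<..} \<Otimes>\<^sub>M S1)
        ((\<lambda>x. (\<rho> x, \<theta> x)) \<circ> (\<lambda>(r, x). smul r x)) =
      distr (radial \<alpha> \<Otimes>\<^sub>M H) (radial \<alpha> \<Otimes>\<^sub>M H) (\<lambda>p. p)"
  proof (rule distr_cong)
    fix p assume "p \<in> space (radial \<alpha> \<Otimes>\<^sub>M H)"
    then show "((\<lambda>x. (\<rho> x, \<theta> x)) \<circ> (\<lambda>(r, x). smul r x)) p = p"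
      by (auto simp: space_pair_measure space_H space_restrict_space
        modulus_smul_unit_sphere angle_smul angle_unit_sphere)
  qed (simp_all only: sets_radial_pair)
  finally show ?thesis by (simp only: distr_id)
qed

text \<open>The composition in the other order, \<open>smul (\<rho> x) (\<theta> x) = x\<close> off
  the origin, recovers \<open>\<nu>\<close> from its polar form; this is the uniqueness behind
  "determined by".\<close>

lemma polar_form_imp_eq_polar_measure:
  assumes "sets \<nu> = sets (restrict_space borel (- {z}))" "has_polar_form \<alpha> \<nu> H"
  shows "\<nu> = polar_measure \<alpha> H"
proof -
  have meas: "(\<lambda>x. (\<rho> x, \<theta> x)) \<in> measurable \<nu> (restrict_space borel {0<..} \<Otimes>\<^sub>M S1)"
    using measurable_polar by (simp only: measurable_cong_sets[OF assms(1) refl])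
  have "polar_measure \<alpha> H =
      distr \<nu> (restrict_space borel (- {z})) ((\<lambda>(r, x). smul r x) \<circ> (\<lambda>x. (\<rho> x, \<theta> x)))"
    unfolding polar_measure_def assms(2)[symmetric]
    by (rule distr_distr[OF measurable_smul meas])
  also have "\<dots> = distr \<nu> \<nu> (\<lambda>x. x)"
    by (rule distr_cong)
      (auto simp: assms(1) smul_angle sets_eq_imp_space_eq[OF assms(1)] space_restrict_space)
  finally show ?thesis by simp
qed

lemma emeasure_polar_measure:
  assumes "0 < c"
  shows "emeasure (polar_measure \<alpha> H) {x. c < \<rho> x} = ennreal (c powr - \<alpha>)"
proof -
  interpret H: prob_space H by (rule prob_H)
  have "emeasure (polar_measure \<alpha> H) {x. c < \<rho> x} =
      emeasure (radial \<alpha> \<Otimes>\<^sub>M H) ((\<lambda>(r, x). smul r x) -` {x. c < \<rho> x} \<inter> space (radial \<alpha> \<Otimes>\<^sub>M H))"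
    unfolding polar_measure_def
    using assms by (intro emeasure_distr[OF measurable_smul_radial] sets_modulus_greater) simp
  also have "(\<lambda>(r, x). smul r x) -` {x. c < \<rho> x} \<inter> space (radial \<alpha> \<Otimes>\<^sub>M H) = {c<..} \<times> space H"
    using assms by (auto simp: space_pair_measure space_restrict_space space_H modulus_smul_unit_sphere)
  also have "emeasure (radial \<alpha> \<Otimes>\<^sub>M H) \<dots> = ennreal (c powr - \<alpha>)"
  proof -
    have "{c<..} \<in> sets (radial \<alpha>)"
      using assms unfolding sets_radial
      by (auto simp: sets_restrict_space intro!: image_eqI[of _ _ "{c<..}"])
    then show ?thesis
      using assms \<alpha> by (subst H.emeasure_pair_measure_Times) (auto simp: emeasure_radial H.emeasure_space_1)
  qed
  finally show ?thesis .
qed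

text \<open>The complement of a neighbourhood of the origin lies in some
  \<open>{x. c / 2 < \<rho> x}\<close>, whose mass is a finite power. The halves of \<open>r\<close>
  and \<open>c\<close> absorb the passage between strict and weak inequalities.\<close>

lemma polar_measure_in_M0: "polar_measure \<alpha> H \<in> M0 z"
  unfolding M0_def
proof (intro CollectI conjI sets_polar_measure allI impI)
  fix U :: "'a set" assume "open U" "z \<in> U"
  then obtain r where r: "0 < r" "ball z r \<subseteq> U" by (metis open_contains_ball)
  obtain c where c: "0 < c" "\<And>x. \<rho> x < c \<Longrightarrow> dist x z \<le> r / 2"
    using dist_origin_le_of_modulus_less[of "r / 2"] r by auto
  have "- U \<subseteq> {x. c / 2 < \<rho> x}"
  proof
    fix x assume "x \<in> - U"
    then have "\<not> dist x z < r" using r by (auto simp: dist_commute subset_iff)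
    then have "\<not> \<rho> x < c" using c(2)[of x] \<open>0 < r\<close> by auto
    then show "x \<in> {x. c / 2 < \<rho> x}" using \<open>0 < c\<close> by auto
  qed
  moreover have "{x. c / 2 < \<rho> x} \<in> sets (polar_measure \<alpha> H)"
    unfolding sets_polar_measure using \<open>0 < c\<close> by (intro sets_modulus_greater) simp
  ultimately have "emeasure (polar_measure \<alpha> H) (- U) \<le> emeasure (polar_measure \<alpha> H) {x. c / 2 < \<rho> x}"
    by (rule emeasure_mono)
  also have "\<dots> < \<infinity>"
    unfolding emeasure_polar_measure[OF half_gt_zero[OF \<open>0 < c\<close>]] by simp
  finally show "emeasure (polar_measure \<alpha> H) (- U) < \<infinity>" .
qed

lemma polar_measure_nonzero: "emeasure (polar_measure \<alpha> H) (space (polar_measure \<alpha> H)) \<noteq> 0"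
  using emeasure_space[of "polar_measure \<alpha> H" "{x. 1 < \<rho> x}"]
  by (auto simp: emeasure_polar_measure)

end

end

section \<open>Convergence of the angle and of the polar coordinates\<close>

locale polar_variable = polar_space z smul \<rho> + prob_space M
  for z :: "'a::polish_space" and smul \<rho> and M :: "'b measure" +
  fixes X :: "'b \<Rightarrow> 'a" and \<alpha> :: real
  assumes X [measurable]: "X \<in> measurable M borel" and \<alpha>: "0 < \<alpha>"
begin

abbreviation "exceed u \<equiv> {\<omega> \<in> space M. \<rho> (X \<omega>) > u}"
abbreviation "tail u \<equiv> measure M (exceed u)"
abbreviation "angle_law u \<equiv> cond_law M (exceed u) S1 (\<lambda>\<omega>. \<theta> (X \<omega>))"
abbreviation "polar_law u \<equiv>
  cond_law M (exceed u) (borel \<Otimes>\<^sub>M S1) (\<lambda>\<omega>. (\<rho> (X \<omega>) / u, \<theta> (X \<omega>)))"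

text \<open>Kept without normalisation on purpose: divided by \<open>tail u\<close> it is the mean
  of \<open>k\<close> under the conditional angular law, divided by \<open>V u\<close> it is the
  quantity that convergence in \<open>M0\<close> controls.\<close>

definition trunc :: "('a \<Rightarrow> real) \<Rightarrow> real \<Rightarrow> real" where
  "trunc k u = (\<integral>\<omega>. indicator {u<..} (\<rho> (X \<omega>)) * k (\<theta> (X \<omega>)) \<partial>M)"

lemma sets_exceed: "exceed u \<in> events"
  by measurable

lemma measurable_X_exceed:
  assumes "0 \<le> u"
  shows "X \<in> measurable (restrict_space M (exceed u)) (restrict_space borel (- {z}))"
proof (rule measurable_restrict_space2[OF _ measurable_restrict_space1[OF X]])
  have "\<rho> z = 0" by (simp add: modulus_eq_0_iff)
  then show "X \<in> space (restrict_space M (exceed u)) \<rightarrow> - {z}"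
    using assms by (auto simp: space_restrict_space)
qed

lemma measurable_angle_X:
  "0 \<le> u \<Longrightarrow> (\<lambda>\<omega>. \<theta> (X \<omega>)) \<in> measurable (restrict_space M (exceed u)) S1"
  by (rule measurable_compose[OF measurable_X_exceed measurable_angle])

lemma measurable_polar_X:
  assumes "0 \<le> u"
  shows "(\<lambda>\<omega>. (\<rho> (X \<omega>) / v, \<theta> (X \<omega>))) \<in> measurable (restrict_space M (exceed u)) (borel \<Otimes>\<^sub>M S1)"
proof (rule measurable_Pair[OF measurable_restrict_space1 measurable_angle_X[OF assms]])
  show "(\<lambda>\<omega>. \<rho> (X \<omega>) / v) \<in> borel_measurable M" by measurable
qed

lemma integrable_exceed:
  fixes g :: "real \<times> 'a \<Rightarrow> real"
  assumes "0 \<le> u" and g: "g \<in> borel_measurable (borel \<Otimes>\<^sub>M S1)"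
    and B: "\<And>r x. x \<in> unit_sphere \<rho> \<Longrightarrow> \<bar>g (r, x)\<bar> \<le> B"
  shows "integrable M (\<lambda>\<omega>. indicator {u<..} (\<rho> (X \<omega>)) * g (\<rho> (X \<omega>) / v, \<theta> (X \<omega>)))"
\<comment> \<open>The integrand vanishes off the event, so its bound must be nonnegative, whereas an
  empty unit sphere would admit a negative \<open>B\<close>.\<close>
proof (rule integrable_const_bound[of _ "max 0 B"], rule AE_I2)
  fix \<omega>
  show "norm (indicator {u<..} (\<rho> (X \<omega>)) * g (\<rho> (X \<omega>) / v, \<theta> (X \<omega>))) \<le> max 0 B"
  proof (cases "u < \<rho> (X \<omega>)")
    case True
    then have "X \<omega> \<noteq> z" using assms(1) by (auto simp flip: modulus_pos_iff)
    then show ?thesis using True B[OF angle_in_unit_sphere, of "X \<omega>" "\<rho> (X \<omega>) / v"] by simp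
  qed simp
next
  have "(\<lambda>\<omega>. g (\<rho> (X \<omega>) / v, \<theta> (X \<omega>))) \<in> borel_measurable (restrict_space M (exceed u))"
    by (rule measurable_compose[OF measurable_polar_X[OF assms(1)] g])
  then have "(\<lambda>\<omega>. indicator (exceed u) \<omega> * g (\<rho> (X \<omega>) / v, \<theta> (X \<omega>))) \<in> borel_measurable M"
    using sets_exceed by (simp add: borel_measurable_restrict_space_iff)
  then show "(\<lambda>\<omega>. indicator {u<..} (\<rho> (X \<omega>)) * g (\<rho> (X \<omega>) / v, \<theta> (X \<omega>))) \<in> borel_measurable M"
    by (rule measurable_cong[THEN iffD1, rotated]) (simp add: indicator_def)
qed

lemma integral_polar_law:
  fixes g :: "real \<times> 'a \<Rightarrow> real"
  assumes "0 \<le> u" and g: "g \<in> borel_measurable (borel \<Otimes>\<^sub>M S1)"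
  shows "(\<integral>p. g p \<partial>polar_law u) =
    (\<integral>\<omega>. indicator {u<..} (\<rho> (X \<omega>)) * g (\<rho> (X \<omega>) / u, \<theta> (X \<omega>)) \<partial>M) / tail u"
proof -
  have "emeasure M (exceed u) \<noteq> \<infinity>" by simp
  from integral_cond_law[OF sets_exceed this measurable_polar_X[OF assms(1)] g, of u]
  have "(\<integral>p. g p \<partial>polar_law u) =
      (\<integral>\<omega>. indicator (exceed u) \<omega> * g (\<rho> (X \<omega>) / u, \<theta> (X \<omega>)) \<partial>M) / tail u" .
  also have "(\<integral>\<omega>. indicator (exceed u) \<omega> * g (\<rho> (X \<omega>) / u, \<theta> (X \<omega>)) \<partial>M) =
      (\<integral>\<omega>. indicator {u<..} (\<rho> (X \<omega>)) * g (\<rho> (X \<omega>) / u, \<theta> (X \<omega>)) \<partial>M)"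
    by (rule Bochner_Integration.integral_cong) (simp_all add: indicator_def)
  finally show ?thesis .
qed

lemma integral_angle_law:
  fixes k :: "'a \<Rightarrow> real"
  assumes "0 \<le> u" and k: "continuous_on (unit_sphere \<rho>) k"
  shows "(\<integral>x. k x \<partial>angle_law u) = trunc k u / tail u"
proof -
  have "emeasure M (exceed u) \<noteq> \<infinity>" by simp
  from integral_cond_law[OF sets_exceed this measurable_angle_X[OF assms(1)]
      borel_measurable_continuous_on_restrict[OF k]]
  have "(\<integral>x. k x \<partial>angle_law u) = (\<integral>\<omega>. indicator (exceed u) \<omega> * k (\<theta> (X \<omega>)) \<partial>M) / tail u" .
  also have "(\<integral>\<omega>. indicator (exceed u) \<omega> * k (\<theta> (X \<omega>)) \<partial>M) = trunc k u"
    unfolding trunc_def by (rule Bochner_Integration.integral_cong) (simp_all add: indicator_def)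
  finally show ?thesis .
qed

lemma borel_measurable_snd_continuous:
  fixes k :: "'a \<Rightarrow> real"
  assumes k: "continuous_on (unit_sphere \<rho>) k"
  shows "(\<lambda>p. k (snd p)) \<in> borel_measurable (borel \<Otimes>\<^sub>M S1)"
  by (rule measurable_compose[OF measurable_snd borel_measurable_continuous_on_restrict[OF k]])

lemma integrable_trunc:
  fixes k :: "'a \<Rightarrow> real"
  assumes "0 \<le> u" "continuous_on (unit_sphere \<rho>) k" "\<And>x. x \<in> unit_sphere \<rho> \<Longrightarrow> \<bar>k x\<bar> \<le> B"
  shows "integrable M (\<lambda>\<omega>. indicator {u<..} (\<rho> (X \<omega>)) * k (\<theta> (X \<omega>)))"
  using integrable_exceed[OF assms(1) borel_measurable_snd_continuous[OF assms(2)], of B 1] assms(3) by simp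

lemma trunc_1: "trunc (\<lambda>_. 1) u = tail u"
proof -
  have "trunc (\<lambda>_. 1) u = (\<integral>\<omega>. indicator (exceed u) \<omega> \<partial>M)"
    unfolding trunc_def by (intro Bochner_Integration.integral_cong) (auto simp: indicator_def)
  also have "\<dots> = tail u" using sets_exceed by (simp add: Int_absorb2)
  finally show ?thesis .
qed

lemma trunc_add_const:
  fixes k :: "'a \<Rightarrow> real"
  assumes "0 \<le> u" "continuous_on (unit_sphere \<rho>) k" "\<And>x. x \<in> unit_sphere \<rho> \<Longrightarrow> \<bar>k x\<bar> \<le> B"
  shows "trunc (\<lambda>x. k x + c) u = trunc k u + c * tail u"
proof -
  have "integrable M (\<lambda>\<omega>. indicator {u<..} (\<rho> (X \<omega>)) * (c :: real))"
    by (rule integrable_trunc[OF assms(1), of "\<lambda>_. c" "\<bar>c\<bar>"]) auto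
  then have "trunc (\<lambda>x. k x + c) u =
      trunc k u + (\<integral>\<omega>. indicator {u<..} (\<rho> (X \<omega>)) * c \<partial>M)"
    unfolding trunc_def distrib_left
    by (intro Bochner_Integration.integral_add integrable_trunc[OF assms])
  also have "(\<integral>\<omega>. indicator {u<..} (\<rho> (X \<omega>)) * c \<partial>M) = c * trunc (\<lambda>_. 1) u"
    by (simp add: trunc_def mult.commute)
  finally show ?thesis by (simp add: trunc_1)
qed

lemma trunc_ramp_bounds:
  fixes k :: "'a \<Rightarrow> real"
  assumes "0 < u" "0 \<le> b" "b < a" and k: "continuous_on (unit_sphere \<rho>) k"
    and B: "\<And>x. x \<in> unit_sphere \<rho> \<Longrightarrow> 0 \<le> k x \<and> k x \<le> B"
  shows "trunc k (a * u) \<le> (\<integral>\<omega>. ramp b a (\<rho> (X \<omega>) / u) * k (\<theta> (X \<omega>)) \<partial>M)" (is "_ \<le> integral\<^sup>L M ?R")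
    and "(\<integral>\<omega>. ramp b a (\<rho> (X \<omega>) / u) * k (\<theta> (X \<omega>)) \<partial>M) \<le> trunc k (b * u)"
proof -
  have B': "\<bar>k x\<bar> \<le> B" if "x \<in> unit_sphere \<rho>" for x using B[OF that] by simp
  have k_nonneg: "0 \<le> k (\<theta> (X \<omega>))" if "0 < \<rho> (X \<omega>)" for \<omega>
    using that B[OF angle_in_unit_sphere] by (auto simp: modulus_pos_iff)
  \<comment> \<open>At the origin the angle need not lie on the unit sphere, so the sign and size of
    \<open>k\<close> are unknown there. As \<open>0 \<le> b\<close>, the ramp vanishes at that
    point, and an indicator of \<open>\<rho> > 0\<close> may be inserted freely.\<close>
  have ramp_0: "?R \<omega> = 0" if "\<rho> (X \<omega>) \<le> 0" for \<omega>
    using that modulus_nonneg[of "X \<omega>"] assms(2,3) by (auto simp: ramp_def divide_simps)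
  have ind: "indicator {c * u<..} (\<rho> (X \<omega>)) = (indicator {c<..} (\<rho> (X \<omega>) / u) :: real)" for c \<omega>
    using \<open>0 < u\<close> by (auto simp: indicator_def field_simps)
  have "integrable M (\<lambda>\<omega>. indicator {0<..} (\<rho> (X \<omega>)) * (ramp b a (fst (\<rho> (X \<omega>) / u, \<theta> (X \<omega>))) * k (snd (\<rho> (X \<omega>) / u, \<theta> (X \<omega>)))))"
  proof (rule integrable_exceed[where g = "\<lambda>p. ramp b a (fst p) * k (snd p)"])
    show "(\<lambda>p. ramp b a (fst p) * k (snd p)) \<in> borel_measurable (borel \<Otimes>\<^sub>M S1)"
      using borel_measurable_snd_continuous[OF k] by measurable
    show "\<bar>ramp b a (fst (r, x)) * k (snd (r, x))\<bar> \<le> B" if "x \<in> unit_sphere \<rho>" for r x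
      using B[OF that] mult_mono[of "ramp b a r" 1 "k x" B] ramp_nonneg[of b a r] ramp_le_1[of b a r]
      by (simp add: abs_mult)
  qed simp
  also have "(\<lambda>\<omega>. indicator {0<..} (\<rho> (X \<omega>)) * (ramp b a (fst (\<rho> (X \<omega>) / u, \<theta> (X \<omega>))) * k (snd (\<rho> (X \<omega>) / u, \<theta> (X \<omega>))))) = ?R"
  proof
    fix \<omega> show "indicator {0<..} (\<rho> (X \<omega>)) * (ramp b a (fst (\<rho> (X \<omega>) / u, \<theta> (X \<omega>)))
        * k (snd (\<rho> (X \<omega>) / u, \<theta> (X \<omega>)))) = ?R \<omega>"
      using ramp_0[of \<omega>] by (cases "0 < \<rho> (X \<omega>)") auto
  qed
  finally have int: "integrable M ?R" .
  have le: "indicator {a<..} (\<rho> (X \<omega>) / u) * k (\<theta> (X \<omega>)) \<le> ?R \<omega>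
      \<and> ?R \<omega> \<le> indicator {b<..} (\<rho> (X \<omega>) / u) * k (\<theta> (X \<omega>))" for \<omega>
  proof (cases "0 < \<rho> (X \<omega>)")
    case True
    then show ?thesis using k_nonneg ramp_bounds[OF \<open>b < a\<close>] by (auto intro: mult_right_mono)
  next
    case False
    then show ?thesis using ramp_0[of \<omega>] modulus_nonneg[of "X \<omega>"] assms(1-3)
      by (auto simp: indicator_def divide_simps split: if_splits)
  qed
  show "trunc k (a * u) \<le> integral\<^sup>L M ?R"
    unfolding trunc_def
    by (rule integral_mono[OF integrable_trunc[OF _ k B'] int]) (use le \<open>0 < u\<close> \<open>0 \<le> b\<close> \<open>b < a\<close> in \<open>simp_all add: ind\<close>)
  show "integral\<^sup>L M ?R \<le> trunc k (b * u)"
    unfolding trunc_def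
    by (rule integral_mono[OF int integrable_trunc[OF _ k B']]) (use le \<open>0 < u\<close> \<open>0 \<le> b\<close> \<open>b < a\<close> in \<open>simp_all add: ind\<close>)
qed

lemma eventually_scaled_at_top: "\<forall>\<^sub>F u in at_top. P u \<Longrightarrow> 0 < l \<Longrightarrow> \<forall>\<^sub>F u in at_top. P (l * u)" for l :: real
  by (erule eventually_compose_filterlim)
    (intro filterlim_tendsto_pos_mult_at_top[OF tendsto_const] filterlim_ident)

lemma tail_pos_of_reg_var: "reg_var \<tau> tail \<Longrightarrow> \<forall>\<^sub>F u in at_top. 0 < tail u"
  by (auto simp: reg_var_def eventually_at_top_dense)

text \<open>The measurability required by the class is automatic: the tail probability is monotone
  in \<open>u\<close>.\<close>

lemma reg_var_tailI:
  assumes "\<forall>\<^sub>F u in at_top. 0 < tail u" "\<And>l. 0 < l \<Longrightarrow> ((\<lambda>u. tail (l * u) / tail u) \<longlongrightarrow> l powr \<tau>) at_top"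
  shows "reg_var \<tau> tail"
  unfolding reg_var_def
proof (intro conjI allI impI assms(2))
  obtain u0 where u0: "\<forall>u>u0. 0 < tail u" using assms(1) unfolding eventually_at_top_dense by blast
  have "mono (\<lambda>u. - tail u)"
    by (auto simp: mono_def intro!: finite_measure_mono sets_exceed)
  from borel_measurable_uminus[OF borel_measurable_mono[OF this]]
  have "tail \<in> borel_measurable borel" by simp
  then show "\<exists>u0. tail \<in> borel_measurable (restrict_space borel {u0<..}) \<and> (\<forall>u>u0. 0 < tail u)"
    using u0 measurable_restrict_space1 by blast
qed

text \<open>Conditioning already forces \<open>\<rho> (X \<omega>) / u > 1\<close>, so a half-line
  that begins below 1 is cut at 1.\<close>

lemma integral_polar_law_half_line:
  fixes k :: "'a \<Rightarrow> real"
  assumes "0 < u" and k: "continuous_on (unit_sphere \<rho>) k"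
  shows "(\<integral>p. indicator {a<..} (fst p) * k (snd p) \<partial>polar_law u) = trunc k (max 1 a * u) / tail u"
proof -
  have "(\<lambda>p. indicator {a<..} (fst p) * k (snd p)) \<in> borel_measurable (borel \<Otimes>\<^sub>M S1)"
    using borel_measurable_snd_continuous[OF k] by measurable
  from integral_polar_law[OF less_imp_le[OF \<open>0 < u\<close>] this]
  have "(\<integral>p. indicator {a<..} (fst p) * k (snd p) \<partial>polar_law u) =
      (\<integral>\<omega>. indicator {u<..} (\<rho> (X \<omega>)) * (indicator {a<..} (\<rho> (X \<omega>) / u) * k (\<theta> (X \<omega>))) \<partial>M) / tail u"
    by simp
  also have "(\<lambda>\<omega>. indicator {u<..} (\<rho> (X \<omega>)) * (indicator {a<..} (\<rho> (X \<omega>) / u) * k (\<theta> (X \<omega>)))) =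
      (\<lambda>\<omega>. indicator {max 1 a * u<..} (\<rho> (X \<omega>)) * k (\<theta> (X \<omega>)))"
  proof -
    have "u < r \<and> a < r / u \<longleftrightarrow> max 1 a * u < r" for r
      using \<open>0 < u\<close> by (auto simp: less_divide_eq max_mult_distrib_right)
    then show ?thesis by (auto simp: indicator_def fun_eq_iff)
  qed
  finally show ?thesis unfolding trunc_def .
qed

section \<open>From angular convergence to polar convergence\<close>

context
  fixes H :: "'a measure"
  assumes H: "prob_on (unit_sphere \<rho>) H"
begin

lemma prob_space_pareto_pair: "prob_space (pareto \<alpha> \<Otimes>\<^sub>M H)"
proof -
  interpret P: real_distribution "pareto \<alpha>" using \<alpha> by (rule real_distribution_pareto)
  interpret H: prob_space H using H by (rule prob_on_D)
  interpret PH: pair_prob_space "pareto \<alpha>" H ..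
  show ?thesis by (rule PH.prob_space_axioms)
qed

lemma sets_pareto_pair: "sets (pareto \<alpha> \<Otimes>\<^sub>M H) = sets (borel \<Otimes>\<^sub>M S1)"
  by (intro sets_pair_measure_cong prob_on_D(1)[OF H]) (simp add: pareto_def)

lemma integral_pareto_pair_indicator:
  fixes k :: "'a \<Rightarrow> real"
  assumes k: "continuous_on (unit_sphere \<rho>) k" "bounded (k ` unit_sphere \<rho>)" and "B \<in> sets borel"
  shows "(\<integral>p. indicator B (fst p) * k (snd p) \<partial>(pareto \<alpha> \<Otimes>\<^sub>M H)) = measure (pareto \<alpha>) B * (\<integral>x. k x \<partial>H)"
proof -
  interpret P: real_distribution "pareto \<alpha>" using \<alpha> by (rule real_distribution_pareto)
  obtain K where "\<And>x. x \<in> unit_sphere \<rho> \<Longrightarrow> \<bar>k x\<bar> \<le> K" using k(2) by (auto simp: bounded_iff)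
  moreover have "k \<in> borel_measurable H"
    using borel_measurable_continuous_on_restrict[OF k(1)]
    by (simp add: measurable_cong_sets[OF prob_on_D(1)[OF H] refl])
  ultimately show ?thesis using \<open>B \<in> sets borel\<close>
    by (intro integral_pair_indicator_mult[where K = K] P.prob_space_axioms prob_on_D(2)[OF H])
      (auto simp: prob_on_D(3)[OF H])
qed

text \<open>With \<open>b = max 1 a\<close>, the half-line integral factors as
  \<open>trunc k (b * u) / tail (b * u)\<close> times \<open>tail (b * u) / tail u\<close>. The
  first factor is angular convergence along \<open>b * u\<close>, the second is regular variation,
  and the independence of the limit laws is this product form.\<close>

lemma polar_conv_of_angle_conv:
  assumes rv: "reg_var (- \<alpha>) tail" and conv: "weak_tendsto (unit_sphere \<rho>) angle_law H at_top"
  shows "weak_tendsto (UNIV \<times> unit_sphere \<rho>) polar_law (pareto \<alpha> \<Otimes>\<^sub>M H) at_top"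
proof (rule weak_tendsto_from_half_lines)
  note pos = tail_pos_of_reg_var[OF rv]
  from pos eventually_gt_at_top[of 0] show "\<forall>\<^sub>F u in at_top. prob_space (polar_law u)"
    by eventually_elim
      (intro prob_space_cond_law sets_exceed measurable_polar_X, auto simp: emeasure_eq_measure)
  show "prob_space (pareto \<alpha> \<Otimes>\<^sub>M H)" by (rule prob_space_pareto_pair)
  show "sets (pareto \<alpha> \<Otimes>\<^sub>M H) = sets (borel \<Otimes>\<^sub>M S1)" by (rule sets_pareto_pair)
  show "sets (polar_law u) = sets (borel \<Otimes>\<^sub>M S1)" for u by simp
  fix a :: real and k :: "'a \<Rightarrow> real"
  assume k: "continuous_on (unit_sphere \<rho>) k" "bounded (k ` unit_sphere \<rho>)"
  let ?b = "max 1 a"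
  have "((\<lambda>u. trunc k u / tail u) \<longlongrightarrow> (\<integral>x. k x \<partial>H)) at_top"
  proof (rule Lim_transform_eventually)
    show "((\<lambda>u. \<integral>x. k x \<partial>angle_law u) \<longlongrightarrow> (\<integral>x. k x \<partial>H)) at_top"
      using conv k unfolding weak_tendsto_def by blast
    show "\<forall>\<^sub>F u in at_top. (\<integral>x. k x \<partial>angle_law u) = trunc k u / tail u"
      using eventually_ge_at_top[of 0] by eventually_elim (rule integral_angle_law[OF _ k(1)])
  qed
  moreover have "filterlim (\<lambda>u. ?b * u) at_top at_top"
    by (intro filterlim_tendsto_pos_mult_at_top[OF tendsto_const] filterlim_ident) simp
  ultimately have "((\<lambda>u. trunc k (?b * u) / tail (?b * u)) \<longlongrightarrow> (\<integral>x. k x \<partial>H)) at_top"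
    by (rule filterlim_compose)
  moreover have "((\<lambda>u. tail (?b * u) / tail u) \<longlongrightarrow> ?b powr - \<alpha>) at_top"
    using rv unfolding reg_var_def by (simp add: max_def)
  ultimately have "((\<lambda>u. trunc k (?b * u) / tail (?b * u) * (tail (?b * u) / tail u))
      \<longlongrightarrow> (\<integral>x. k x \<partial>H) * ?b powr - \<alpha>) at_top"
    by (rule tendsto_mult)
  moreover have "\<forall>\<^sub>F u in at_top. 0 < tail (?b * u)"
    by (rule eventually_scaled_at_top[OF pos]) simp
  then have "\<forall>\<^sub>F u in at_top. trunc k (?b * u) / tail (?b * u) * (tail (?b * u) / tail u) =
      (\<integral>p. indicator {a<..} (fst p) * k (snd p) \<partial>polar_law u)"
    using eventually_gt_at_top[of 0]
  proof eventually_elim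
    case (elim u)
    then show ?case using integral_polar_law_half_line[OF _ k(1), of u a] by simp
  qed
  ultimately show "((\<lambda>u. \<integral>p. indicator {a<..} (fst p) * k (snd p) \<partial>polar_law u)
      \<longlongrightarrow> (\<integral>p. indicator {a<..} (fst p) * k (snd p) \<partial>(pareto \<alpha> \<Otimes>\<^sub>M H))) at_top"
    using integral_pareto_pair_indicator[OF k, of "{a<..}"]
    by (simp add: measure_pareto_greaterThan[OF \<alpha>] mult.commute tendsto_cong)
qed

section \<open>Regular variation of the tail from polar convergence\<close>

context
  assumes conv: "weak_tendsto (UNIV \<times> unit_sphere \<rho>) polar_law (pareto \<alpha> \<Otimes>\<^sub>M H) at_top"
begin

text \<open>For an event of probability zero the conditional law is the zero measure, which the
  constant test function 1 excludes for large \<open>u\<close>, the limit having mass one.\<close>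

lemma tail_pos_of_polar_conv: "\<forall>\<^sub>F u in at_top. 0 < tail u"
proof -
  interpret Q: prob_space "pareto \<alpha> \<Otimes>\<^sub>M H" by (rule prob_space_pareto_pair)
  have "((\<lambda>u. \<integral>p. (1 :: real) \<partial>polar_law u) \<longlongrightarrow> (\<integral>p. 1 \<partial>(pareto \<alpha> \<Otimes>\<^sub>M H))) at_top"
    by (intro conv[unfolded weak_tendsto_def, rule_format] conjI) (auto simp: bounded_iff)
  then have "\<forall>\<^sub>F u in at_top. 0 < (\<integral>p. (1 :: real) \<partial>polar_law u)"
    by (rule order_tendstoD) (simp add: Q.prob_space)
  with eventually_ge_at_top[of 0] show ?thesis
  proof eventually_elim
    case (elim u)
    then have "tail u \<noteq> 0" using integral_polar_law[of u "\<lambda>_. 1"] by auto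
    then show ?case by (simp add: less_le)
  qed
qed

text \<open>For \<open>l > 1\<close> the ratio \<open>tail (l * u) / tail u\<close> is a conditional
  probability that depends on the radius only. Its convergence is that of the Pareto tail, by
  squeezing, since the map \<open>l \<mapsto> l powr - \<alpha>\<close> is continuous.\<close>

lemma reg_var_of_polar_conv: "reg_var (- \<alpha>) tail"
proof (rule reg_var_tailI[OF tail_pos_of_polar_conv])
  interpret Q: prob_space "pareto \<alpha> \<Otimes>\<^sub>M H" by (rule prob_space_pareto_pair)
  have gt1: "((\<lambda>u. tail (l * u) / tail u) \<longlongrightarrow> l powr - \<alpha>) at_top" if "1 < l" for l
  proof (rule tendsto_squeeze_thresholds[where c = 1 and q = "\<lambda>u l. tail (l * u) / tail u"
        and h = "\<lambda>l. l powr - \<alpha>" and p = "\<lambda>u b a. \<integral>p. ramp b a (fst p) \<partial>polar_law u"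
        and l = "\<lambda>b a. \<integral>p. ramp b a (fst p) \<partial>(pareto \<alpha> \<Otimes>\<^sub>M H)"])
    fix b a :: real
    assume ba: "1 \<le> b" "b < a"
    show "\<forall>\<^sub>F u in at_top. tail (a * u) / tail u \<le> (\<integral>p. ramp b a (fst p) \<partial>polar_law u) \<and>
        (\<integral>p. ramp b a (fst p) \<partial>polar_law u) \<le> tail (b * u) / tail u"
      using tail_pos_of_polar_conv eventually_gt_at_top[of 0]
    proof eventually_elim
      case (elim u)
      \<comment> \<open>As \<open>1 \<le> b\<close>, the ramp is zero unless
        \<open>\<rho> (X \<omega>) > u\<close>, so the indicator of the conditioning event is
        redundant.\<close>
      have absorb: "indicator {u<..} (\<rho> (X \<omega>)) * ramp b a (\<rho> (X \<omega>) / u) = ramp b a (\<rho> (X \<omega>) / u)" for \<omega>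
      proof (cases "u < \<rho> (X \<omega>)")
        case False
        have "u \<le> b * u" using elim ba by simp
        with False have "\<not> b * u < \<rho> (X \<omega>)" by linarith
        then have "\<not> b < \<rho> (X \<omega>) / u" using elim by (simp add: less_divide_eq)
        then show ?thesis
          using ramp_bounds(2)[OF ba(2), of "\<rho> (X \<omega>) / u"] ramp_nonneg[of b a "\<rho> (X \<omega>) / u"]
          by simp
      qed simp
      have "(\<integral>p. ramp b a (fst p) \<partial>polar_law u) = (\<integral>\<omega>. ramp b a (\<rho> (X \<omega>) / u) * 1 \<partial>M) / tail u"
        using elim by (subst integral_polar_law) (simp_all only: fst_conv absorb mult_1_right, measurable)
      then show ?case
        using trunc_ramp_bounds[of u b a "\<lambda>_. 1" 1] elim ba
        by (simp add: trunc_1 divide_right_mono)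
    qed
  next
    fix b a :: real
    assume ba: "1 < b" "b < a"
    have "continuous_on (UNIV \<times> unit_sphere \<rho>) (\<lambda>p :: real \<times> 'a. ramp b a (fst p))"
      by (intro continuous_intros)
    moreover have "bounded ((\<lambda>p :: real \<times> 'a. ramp b a (fst p)) ` (UNIV \<times> unit_sphere \<rho>))"
      unfolding bounded_iff using ramp_nonneg ramp_le_1 by (intro exI[of _ 1]) auto
    ultimately show "((\<lambda>u. \<integral>p. ramp b a (fst p) \<partial>polar_law u) \<longlongrightarrow>
        (\<integral>p. ramp b a (fst p) \<partial>(pareto \<alpha> \<Otimes>\<^sub>M H))) at_top"
      using conv unfolding weak_tendsto_def by blast
    interpret H: prob_space H using H by (rule prob_on_D)
    have meas: "(\<lambda>p. ramp b a (fst p)) \<in> borel_measurable (pareto \<alpha> \<Otimes>\<^sub>M H)"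
      "(\<lambda>p. indicator {c<..} (fst p) :: real) \<in> borel_measurable (pareto \<alpha> \<Otimes>\<^sub>M H)" for c
      unfolding measurable_cong_sets[OF sets_pareto_pair refl] by measurable
    have int: "integrable (pareto \<alpha> \<Otimes>\<^sub>M H) (\<lambda>p. ramp b a (fst p))"
      "integrable (pareto \<alpha> \<Otimes>\<^sub>M H) (\<lambda>p. indicator {c<..} (fst p) :: real)" for c
      using ramp_nonneg ramp_le_1
      by (auto intro!: Q.integrable_const_bound[of _ 1] meas)
    have val: "(\<integral>p. indicator {c<..} (fst p) \<partial>(pareto \<alpha> \<Otimes>\<^sub>M H)) = c powr - \<alpha>" if "1 < c" for c
      using integral_pareto_pair_indicator[of "\<lambda>_. 1" "{c<..}"] that
      by (simp add: measure_pareto_greaterThan[OF \<alpha>] H.prob_space image_constant_conv)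
    show "a powr - \<alpha> \<le> (\<integral>p. ramp b a (fst p) \<partial>(pareto \<alpha> \<Otimes>\<^sub>M H)) \<and>
        (\<integral>p. ramp b a (fst p) \<partial>(pareto \<alpha> \<Otimes>\<^sub>M H)) \<le> b powr - \<alpha>"
      unfolding val[OF ba(1), symmetric] val[OF less_trans[OF ba], symmetric]
      by (intro conjI integral_mono int ramp_bounds ba)
  next
    show "isCont (\<lambda>l. l powr - \<alpha>) l" using that by (auto intro!: continuous_intros)
  qed fact
  fix l :: real assume "0 < l"
  consider "1 < l" | "l = 1" | "l < 1" by linarith
  then show "((\<lambda>u. tail (l * u) / tail u) \<longlongrightarrow> l powr - \<alpha>) at_top"
  proof cases
    case 1 then show ?thesis by (rule gt1)
  next
    case 2
    have "\<forall>\<^sub>F u in at_top. tail (l * u) / tail u = l powr - \<alpha>"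
      using tail_pos_of_polar_conv by eventually_elim (simp add: 2)
    then show ?thesis by (rule tendsto_eventually)
  next
    \<comment> \<open>A ratio below 1 is invisible to the conditional law: the case
      \<open>inverse l\<close> is used along \<open>l * u\<close> and the limit is inverted.\<close>
    case 3
    have "filterlim (\<lambda>u. l * u) at_top at_top"
      using \<open>0 < l\<close> by (intro filterlim_tendsto_pos_mult_at_top[OF tendsto_const] filterlim_ident)
    moreover have "((\<lambda>u. tail (inverse l * u) / tail u) \<longlongrightarrow> inverse l powr - \<alpha>) at_top"
      using 3 \<open>0 < l\<close> by (intro gt1) (simp add: one_less_inverse)
    ultimately have "((\<lambda>u. tail (inverse l * (l * u)) / tail (l * u)) \<longlongrightarrow> inverse l powr - \<alpha>) at_top"
      by (rule filterlim_compose[rotated])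
    then have "((\<lambda>u. inverse (tail (inverse l * (l * u)) / tail (l * u))) \<longlongrightarrow> inverse (inverse l powr - \<alpha>)) at_top"
      using \<open>0 < l\<close> by (intro tendsto_inverse) auto
    then show ?thesis using \<open>0 < l\<close> by (simp add: powr_minus powr_divide inverse_eq_divide flip: mult.assoc)
  qed
qed

end

end

end

section \<open>Convergence in \<open>M\<^sub>0\<close>\<close>

context polar_variable
begin

text \<open>The integrand is controlled off the origin only, hence the indicator. It may be
  evaluated at \<open>X \<omega>\<close> instead of the scaled point, because scaling by a positive
  factor sends exactly the origin to the origin.\<close>

lemma integral_scaled_law:
  fixes f :: "'a \<Rightarrow> real"
  assumes "0 < u" "0 \<le> v" and f: "f \<in> borel_measurable (restrict_space borel (- {z}))"
  shows "(\<integral>x. f x \<partial>scale_measure (ennreal (inverse v)) (scaled_law z smul M X u)) =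
    (\<integral>\<omega>. indicator (- {z}) (X \<omega>) * f (smul (inverse u) (X \<omega>)) \<partial>M) / v"
proof -
  have sets: "- {z} \<in> sets borel" by (intro borel_comp borel_closed closed_singleton)
  have smul_meas: "(\<lambda>\<omega>. smul (inverse u) (X \<omega>)) \<in> measurable M borel"
    using \<open>0 < u\<close>
    by (intro measurable_compose[OF X] borel_measurable_continuous_onI continuous_intros) simp
  have sets': "sets (restrict_space (distr M borel (\<lambda>\<omega>. smul (inverse u) (X \<omega>))) (- {z})) =
      sets (restrict_space borel (- {z}))"
    by (intro sets_restrict_space_cong) simp
  have f': "(\<lambda>x. indicator (- {z}) x * f x) \<in> borel_measurable borel"
    using f sets by (simp add: borel_measurable_restrict_space_iff)
  have "(\<integral>x. f x \<partial>scale_measure (ennreal (inverse v)) (scaled_law z smul M X u)) =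
      inverse v * (\<integral>x. f x \<partial>scaled_law z smul M X u)"
    using assms(2) f unfolding scaled_law_def
    by (intro integral_scale_measure) (simp_all add: measurable_cong_sets[OF sets' refl])
  also have "(\<integral>x. f x \<partial>scaled_law z smul M X u) =
      (\<integral>x. indicator (- {z}) x * f x \<partial>distr M borel (\<lambda>\<omega>. smul (inverse u) (X \<omega>)))"
    unfolding scaled_law_def using sets by (subst integral_restrict_space) auto
  also have "\<dots> = (\<integral>\<omega>. indicator (- {z}) (smul (inverse u) (X \<omega>)) * f (smul (inverse u) (X \<omega>)) \<partial>M)"
    by (rule integral_distr[OF smul_meas f'])
  also have "\<dots> = (\<integral>\<omega>. indicator (- {z}) (X \<omega>) * f (smul (inverse u) (X \<omega>)) \<partial>M)"
    using \<open>0 < u\<close> by (intro Bochner_Integration.integral_cong)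
      (auto simp: indicator_def smul_eq_origin_iff)
  finally show ?thesis by (simp add: divide_inverse mult.commute)
qed

lemma scale_scaled_law_in_M0:
  assumes "0 < u"
  shows "scale_measure (ennreal c) (scaled_law z smul M X u) \<in> M0 z"
proof -
  have sets: "- {z} \<in> sets borel" by (intro borel_comp borel_closed closed_singleton)
  have smul_meas: "(\<lambda>\<omega>. smul (inverse u) (X \<omega>)) \<in> measurable M borel"
    using \<open>0 < u\<close>
    by (intro measurable_compose[OF X] borel_measurable_continuous_onI continuous_intros) simp
  interpret D: prob_space "distr M borel (\<lambda>\<omega>. smul (inverse u) (X \<omega>))"
    by (rule prob_space_distr[OF smul_meas])
  interpret L: finite_measure "scaled_law z smul M X u"
    unfolding scaled_law_def using sets by (intro finite_measure_restrict_space) (auto intro: D.finite_measure_axioms)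
  have "sets (scaled_law z smul M X u) = sets (restrict_space borel (- {z}))"
    unfolding scaled_law_def by (intro sets_restrict_space_cong) simp
  moreover have "emeasure (scaled_law z smul M X u) B < \<top>" for B
    using L.emeasure_finite[of B] by (simp only: top.not_eq_extremum[symmetric]) simp
  ultimately show ?thesis
    unfolding M0_def by (auto simp: ennreal_mult_less_top)
qed

lemma M0_tendsto_polar_measure:
  assumes H: "prob_on (unit_sphere \<rho>) H"
    and conv: "weak_tendsto (UNIV \<times> unit_sphere \<rho>) polar_law (pareto \<alpha> \<Otimes>\<^sub>M H) at_top"
  shows "M0_tendsto z (\<lambda>u. scale_measure (ennreal (inverse (tail u))) (scaled_law z smul M X u))
    (polar_measure \<alpha> H) at_top"
  unfolding M0_tendsto_def
proof (intro conjI allI impI polar_measure_in_M0 \<alpha> H)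
  show "\<forall>\<^sub>F u in at_top. scale_measure (ennreal (inverse (tail u))) (scaled_law z smul M X u) \<in> M0 z"
    using eventually_gt_at_top[of 0] by eventually_elim (rule scale_scaled_law_in_M0)
next
  fix f :: "'a \<Rightarrow> real"
  assume f: "continuous_on (- {z}) f \<and> bounded (f ` (- {z})) \<and>
    (\<exists>r>0. \<forall>x. x \<noteq> z \<longrightarrow> dist x z < r \<longrightarrow> f x = 0)"
  then obtain r where r: "0 < r" "\<And>x. x \<noteq> z \<Longrightarrow> dist x z < r \<Longrightarrow> f x = 0" by blast
  obtain c0 where c0: "0 < c0" "\<And>x. \<rho> x < c0 \<Longrightarrow> dist x z \<le> r / 2"
    using dist_origin_le_of_modulus_less[of "r / 2"] r by auto
  \<comment> \<open>Halving makes the threshold usable with a weak inequality: \<open>f\<close>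
    vanishes for \<open>\<rho> x \<le> c\<close>, the boundary included.\<close>
  define c where "c = c0 / 2"
  have c: "0 < c" using c0 by (simp add: c_def)
  have f_0: "f x = 0" if "x \<noteq> z" "\<rho> x \<le> c" for x
    using that c0(2)[of x] c0(1) r by (force simp: c_def)
  obtain B where B: "\<And>x. x \<noteq> z \<Longrightarrow> \<bar>f x\<bar> \<le> B" using f by (auto simp: bounded_iff)
  \<comment> \<open>This is \<open>f\<close> in the coordinates
    \<open>(\<rho> / c, \<theta>)\<close>, with the radius clamped from below at \<open>c\<close>.
    The clamp avoids the origin and negative multiples, so \<open>G\<close> is continuous on the
    whole of \<open>UNIV \<times> unit_sphere \<rho>\<close>, as weak convergence demands.\<close>
  define G where "G p = f (smul (c * max 1 (fst p)) (snd p))" for p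
  have G_neq: "smul (c * max 1 s) x \<noteq> z" if "x \<in> unit_sphere \<rho>" for s x
    by (rule smul_unit_sphere_neq[OF _ that]) (use c in simp)
  have G_cont: "continuous_on (UNIV \<times> unit_sphere \<rho>) G"
    unfolding G_def
  proof (rule continuous_on_compose2[of "- {z}" f])
    show "continuous_on (UNIV \<times> unit_sphere \<rho>) (\<lambda>p. smul (c * max 1 (fst p)) (snd p))"
      using c by (intro continuous_intros) auto
    show "(\<lambda>p. smul (c * max 1 (fst p)) (snd p)) ` (UNIV \<times> unit_sphere \<rho>) \<subseteq> - {z}"
    proof (rule image_subsetI)
      fix p :: "real \<times> 'a" assume "p \<in> UNIV \<times> unit_sphere \<rho>"
      then have "snd p \<in> unit_sphere \<rho>" by (cases p) simp
      from G_neq[OF this] show "smul (c * max 1 (fst p)) (snd p) \<in> - {z}" by simp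
    qed
  qed (use f in blast)
  have G_B: "\<bar>G p\<bar> \<le> B" if "p \<in> UNIV \<times> unit_sphere \<rho>" for p
    unfolding G_def using that by (intro B G_neq) auto
  have G_meas: "G \<in> borel_measurable (borel \<Otimes>\<^sub>M S1)"
    using borel_measurable_continuous_on_Times[OF G_cont] by simp
  have sets_eq: "sets ((borel :: real measure) \<Otimes>\<^sub>M H) = sets (borel \<Otimes>\<^sub>M S1)"
    by (intro sets_pair_measure_cong prob_on_D(1)[OF H]) simp
  have G_meas_H: "G \<in> borel_measurable (borel \<Otimes>\<^sub>M H)"
    using G_meas unfolding measurable_cong_sets[OF sets_eq refl] .
  have f_G: "f (smul s x) = indicator {c<..} s * G (s / c, x)"
    if "0 < s" "x \<in> unit_sphere \<rho>" for s x
  proof (cases "c < s")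
    case True
    then have "c * max 1 (s / c) = s" using c by (simp add: max_def)
    then have "G (s / c, x) = f (smul s x)" unfolding G_def fst_conv snd_conv by (rule arg_cong)
    then show ?thesis using True by simp
  next
    case False
    then show ?thesis
      using that by (simp add: f_0 smul_unit_sphere_neq modulus_smul_unit_sphere)
  qed
  have f_meas: "f \<in> borel_measurable (restrict_space borel (- {z}))"
    using f by (intro borel_measurable_continuous_on_restrict) auto
  have "(\<integral>x. f x \<partial>polar_measure \<alpha> H) = (\<integral>p. f (case p of (r, x) \<Rightarrow> smul r x) \<partial>(radial \<alpha> \<Otimes>\<^sub>M H))"
    unfolding polar_measure_def by (rule integral_distr[OF measurable_smul_radial[OF \<alpha> H] f_meas])
  also have "\<dots> = (\<integral>p. indicator {c<..} (fst p) * G (fst p / c, snd p) \<partial>(radial \<alpha> \<Otimes>\<^sub>M H))"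
  proof (rule Bochner_Integration.integral_cong[OF refl])
    fix p assume "p \<in> space (radial \<alpha> \<Otimes>\<^sub>M H)"
    then show "f (case p of (r, x) \<Rightarrow> smul r x) = indicator {c<..} (fst p) * G (fst p / c, snd p)"
      by (auto simp: space_pair_measure space_restrict_space prob_on_D(3)[OF H] f_G)
  qed
  also have "\<dots> = c powr - \<alpha> * (\<integral>p. G p \<partial>(pareto \<alpha> \<Otimes>\<^sub>M H))"
    using G_B by (intro integral_radial_pair_eq_pareto[where B = B] \<alpha> c prob_on_D(2)[OF H] G_meas_H)
      (simp add: prob_on_D(3)[OF H])
  finally have lim: "(\<integral>x. f x \<partial>polar_measure \<alpha> H) = c powr - \<alpha> * (\<integral>p. G p \<partial>(pareto \<alpha> \<Otimes>\<^sub>M H))" .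
  have rv: "reg_var (- \<alpha>) tail" by (rule reg_var_of_polar_conv[OF H conv])
  have "filterlim (\<lambda>u. c * u) at_top at_top"
    using c by (intro filterlim_tendsto_pos_mult_at_top[OF tendsto_const] filterlim_ident)
  moreover have "((\<lambda>u. \<integral>p. G p \<partial>polar_law u) \<longlongrightarrow> (\<integral>p. G p \<partial>(pareto \<alpha> \<Otimes>\<^sub>M H))) at_top"
  proof -
    have "bounded (G ` (UNIV \<times> unit_sphere \<rho>))" unfolding bounded_iff using G_B by auto
    then show ?thesis using conv G_cont unfolding weak_tendsto_def by blast
  qed
  ultimately have "((\<lambda>u. \<integral>p. G p \<partial>polar_law (c * u)) \<longlongrightarrow> (\<integral>p. G p \<partial>(pareto \<alpha> \<Otimes>\<^sub>M H))) at_top"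
    by (rule filterlim_compose[rotated])
  moreover have "((\<lambda>u. tail (c * u) / tail u) \<longlongrightarrow> c powr - \<alpha>) at_top"
    using rv c unfolding reg_var_def by blast
  \<comment> \<open>The factor \<open>c powr - \<alpha>\<close> arises on both sides: as the mass
    that the limit measure gives to \<open>\<rho> > c\<close>, and as the limit of the ratio that
    replaces the normalisation at \<open>c * u\<close> by the one at \<open>u\<close>.\<close>
  ultimately have "((\<lambda>u. tail (c * u) / tail u * (\<integral>p. G p \<partial>polar_law (c * u)))
      \<longlongrightarrow> c powr - \<alpha> * (\<integral>p. G p \<partial>(pareto \<alpha> \<Otimes>\<^sub>M H))) at_top"
    by (rule tendsto_mult[rotated])
  then show "((\<lambda>u. \<integral>x. f x \<partial>scale_measure (ennreal (inverse (tail u))) (scaled_law z smul M X u))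
      \<longlongrightarrow> (\<integral>x. f x \<partial>polar_measure \<alpha> H)) at_top"
    unfolding lim
  proof (rule Lim_transform_eventually)
    have "\<forall>\<^sub>F u in at_top. 0 < tail (c * u)"
      by (rule eventually_scaled_at_top[OF tail_pos_of_reg_var[OF rv] c])
    then show "\<forall>\<^sub>F u in at_top. tail (c * u) / tail u * (\<integral>p. G p \<partial>polar_law (c * u)) =
        (\<integral>x. f x \<partial>scale_measure (ennreal (inverse (tail u))) (scaled_law z smul M X u))"
      using eventually_gt_at_top[of 0]
    proof eventually_elim
      case (elim u)
      have pt: "indicator (- {z}) (X \<omega>) * f (smul (inverse u) (X \<omega>)) =
          indicator {c * u<..} (\<rho> (X \<omega>)) * G (\<rho> (X \<omega>) / (c * u), \<theta> (X \<omega>))" for \<omega>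
      proof (cases "X \<omega> = z")
        case True
        then show ?thesis using c elim by (simp add: modulus_eq_0_iff not_less flip: modulus_eq_0_iff)
      next
        case False
        have "smul (inverse u) (X \<omega>) = smul (inverse u * \<rho> (X \<omega>)) (\<theta> (X \<omega>))"
          using elim smul_angle[OF False] smul_smul[of "inverse u" "\<rho> (X \<omega>)" "\<theta> (X \<omega>)"]
          by (simp add: modulus_nonneg)
        moreover have "0 < inverse u * \<rho> (X \<omega>)" using False elim by (simp add: modulus_pos_iff)
        ultimately show ?thesis
          using False elim f_G[OF _ angle_in_unit_sphere[OF False], of "inverse u * \<rho> (X \<omega>)"]
          by (simp add: indicator_def field_simps)
      qed
      have "0 \<le> c * u" using c elim by simp
      from integral_polar_law[OF this G_meas] elim
      show ?case
        by (subst integral_scaled_law[OF _ _ f_meas]) (simp_all add: pt)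
    qed
  qed
qed

lemma regularly_varying_of_polar_conv:
  assumes "prob_on (unit_sphere \<rho>) H"
    and "weak_tendsto (UNIV \<times> unit_sphere \<rho>) polar_law (pareto \<alpha> \<Otimes>\<^sub>M H) at_top"
  shows "regularly_varying z smul M X \<alpha>"
  unfolding regularly_varying_def
  using reg_var_of_polar_conv[OF assms] polar_measure_in_M0[OF \<alpha> assms(1)]
    polar_measure_nonzero[OF \<alpha> assms(1)] M0_tendsto_polar_measure[OF assms]
  by blast

end

section \<open>The angular law of a regularly varying element\<close>

context polar_variable
begin

context
  fixes V :: "real \<Rightarrow> real" and \<mu> :: "'a measure"
  assumes V: "reg_var (- \<alpha>) V" and \<mu>: "\<mu> \<in> M0 z" "emeasure \<mu> (space \<mu>) \<noteq> 0"
    and conv: "M0_tendsto z (\<lambda>u. scale_measure (ennreal (inverse (V u))) (scaled_law z smul M X u)) \<mu> at_top"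
begin

lemma sets_mu: "sets \<mu> = sets (restrict_space borel (- {z}))"
  using \<mu> by (simp add: M0_def)

lemma space_mu: "space \<mu> = - {z}"
  by (simp add: sets_eq_imp_space_eq[OF sets_mu] space_restrict_space)

lemma V_pos: "\<forall>\<^sub>F u in at_top. 0 < V u"
  using V unfolding reg_var_def eventually_at_top_dense by blast

lemma integrable_mu:
  fixes g :: "'a \<Rightarrow> real"
  assumes "g \<in> borel_measurable (restrict_space borel (- {z}))" "0 < b"
    and "\<And>x. x \<noteq> z \<Longrightarrow> \<bar>g x\<bar> \<le> B" "\<And>x. \<rho> x \<le> b \<Longrightarrow> g x = 0"
  shows "integrable \<mu> g"
proof (rule integrableI_bounded_set[where A = "{x. b < \<rho> x}" and B = B])
  show "{x. b < \<rho> x} \<in> sets \<mu>"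
    unfolding sets_mu using \<open>0 < b\<close> by (intro sets_modulus_greater) simp
  show "emeasure \<mu> {x. b < \<rho> x} < \<infinity>" by (rule emeasure_M0_finite[OF \<mu>(1) \<open>0 < b\<close>])
  show "g \<in> borel_measurable \<mu>"
    using assms(1) by (simp only: measurable_cong_sets[OF sets_mu refl])
  show "AE x in \<mu>. x \<in> {x. b < \<rho> x} \<longrightarrow> norm (g x) \<le> B"
    using assms(3) by (intro AE_I2) (auto simp: space_mu)
  show "AE x in \<mu>. x \<notin> {x. b < \<rho> x} \<longrightarrow> g x = 0"
    using assms(4) by (intro AE_I2) auto
qed

lemma borel_measurable_angle_continuous:
  fixes k :: "'a \<Rightarrow> real"
  assumes "continuous_on (unit_sphere \<rho>) k"
  shows "(\<lambda>x. k (\<theta> x)) \<in> borel_measurable (restrict_space borel (- {z}))"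
  by (rule measurable_compose[OF measurable_angle borel_measurable_continuous_on_restrict[OF assms]])

definition mu_trunc :: "('a \<Rightarrow> real) \<Rightarrow> real \<Rightarrow> real" where
  "mu_trunc k a = (\<integral>x. indicator {a<..} (\<rho> x) * k (\<theta> x) \<partial>\<mu>)"

section \<open>Homogeneity of the limit measure\<close>

context
  fixes k :: "'a \<Rightarrow> real" and B :: real
  assumes k: "continuous_on (unit_sphere \<rho>) k"
    and B: "\<And>x. x \<in> unit_sphere \<rho> \<Longrightarrow> 0 \<le> k x \<and> k x \<le> B"
begin

text \<open>The product of ramp and angular function is continuous off the origin and vanishes for
  \<open>\<rho> x \<le> b\<close>, so it is an admissible test function. The angle is invariant
  under scaling, so \<open>u\<close> enters through the radius only.\<close>

lemma ramp_conv:
  assumes "0 < b" "b < a"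
  shows "((\<lambda>u. (\<integral>\<omega>. ramp b a (\<rho> (X \<omega>) / u) * k (\<theta> (X \<omega>)) \<partial>M) / V u)
    \<longlongrightarrow> (\<integral>x. ramp b a (\<rho> x) * k (\<theta> x) \<partial>\<mu>)) at_top"
proof -
  let ?f = "\<lambda>x. ramp b a (\<rho> x) * k (\<theta> x)"
  have f_cont: "continuous_on (- {z}) ?f"
    by (intro continuous_intros continuous_on_compose2[OF k continuous_on_angle])
      (use angle_in_unit_sphere in auto)
  have f_0: "?f x = 0" if "\<rho> x \<le> b" for x
    using ramp_bounds(2)[OF assms(2), of "\<rho> x"] ramp_nonneg[of b a "\<rho> x"] that by simp
  have f_B: "\<bar>?f x\<bar> \<le> B" if "x \<noteq> z" for x
    using B[OF angle_in_unit_sphere[OF that]]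
      mult_mono[of "ramp b a (\<rho> x)" 1 "k (\<theta> x)" B] ramp_nonneg[of b a "\<rho> x"] ramp_le_1[of b a "\<rho> x"]
    by (simp add: abs_mult)
  have "((\<lambda>u. \<integral>x. ?f x \<partial>scale_measure (ennreal (inverse (V u))) (scaled_law z smul M X u))
      \<longlongrightarrow> (\<integral>x. ?f x \<partial>\<mu>)) at_top"
  proof (rule M0_tendsto_integral[OF conv f_cont _ \<open>0 < b\<close>])
    show "bounded (?f ` (- {z}))" unfolding bounded_iff using f_B by auto
  qed (use f_0 in auto)
  then show ?thesis
  proof (rule Lim_transform_eventually)
    show "\<forall>\<^sub>F u in at_top. (\<integral>x. ?f x \<partial>scale_measure (ennreal (inverse (V u))) (scaled_law z smul M X u)) =
        (\<integral>\<omega>. ramp b a (\<rho> (X \<omega>) / u) * k (\<theta> (X \<omega>)) \<partial>M) / V u"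
      using V_pos eventually_gt_at_top[of 0]
    proof eventually_elim
      case (elim u)
      have "indicator (- {z}) (X \<omega>) * ?f (smul (inverse u) (X \<omega>)) =
          ramp b a (\<rho> (X \<omega>) / u) * k (\<theta> (X \<omega>))" for \<omega>
      proof (cases "X \<omega> = z")
        case True
        have "\<rho> z = 0" by (simp add: modulus_eq_0_iff)
        then show ?thesis using True assms by (simp add: ramp_def divide_simps)
      next
        case False
        then show ?thesis using elim
          by (simp add: modulus_smul angle_smul divide_inverse mult.commute)
      qed
      then show ?case
        using elim by (subst integral_scaled_law[OF _ _ borel_measurable_continuous_on_restrict[OF f_cont]]) simp_all
    qed
  qed
qed

text \<open>The integral with thresholds \<open>l * b\<close>, \<open>l * a\<close> at scale
  \<open>u\<close> equals the one with \<open>b\<close>, \<open>a\<close> at scale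
  \<open>l * u\<close>. Renormalising from \<open>V (l * u)\<close> to \<open>V u\<close> costs the
  factor \<open>l powr - \<alpha>\<close>, and limits are unique.\<close>

lemma integral_ramp_mu_mult:
  assumes "0 < b" "b < a" "0 < l"
  shows "(\<integral>x. ramp (l * b) (l * a) (\<rho> x) * k (\<theta> x) \<partial>\<mu>) =
    l powr - \<alpha> * (\<integral>x. ramp b a (\<rho> x) * k (\<theta> x) \<partial>\<mu>)"
proof (rule tendsto_unique[OF trivial_limit_at_top_linorder])
  let ?P = "\<lambda>b a u. \<integral>\<omega>. ramp b a (\<rho> (X \<omega>) / u) * k (\<theta> (X \<omega>)) \<partial>M"
  show "((\<lambda>u. ?P (l * b) (l * a) u / V u) \<longlongrightarrow>
      (\<integral>x. ramp (l * b) (l * a) (\<rho> x) * k (\<theta> x) \<partial>\<mu>)) at_top"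
    using assms by (intro ramp_conv) auto
  have "filterlim (\<lambda>u. l * u) at_top at_top"
    using assms(3) by (intro filterlim_tendsto_pos_mult_at_top[OF tendsto_const] filterlim_ident)
  then have "((\<lambda>u. ?P b a (l * u) / V (l * u)) \<longlongrightarrow> (\<integral>x. ramp b a (\<rho> x) * k (\<theta> x) \<partial>\<mu>)) at_top"
    by (rule filterlim_compose[OF ramp_conv[OF assms(1,2)]])
  moreover have "((\<lambda>u. V (l * u) / V u) \<longlongrightarrow> l powr - \<alpha>) at_top"
    using V assms(3) unfolding reg_var_def by blast
  ultimately have "((\<lambda>u. V (l * u) / V u * (?P b a (l * u) / V (l * u))) \<longlongrightarrow>
      l powr - \<alpha> * (\<integral>x. ramp b a (\<rho> x) * k (\<theta> x) \<partial>\<mu>)) at_top"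
    by (rule tendsto_mult[rotated])
  then show "((\<lambda>u. ?P (l * b) (l * a) u / V u) \<longlongrightarrow>
      l powr - \<alpha> * (\<integral>x. ramp b a (\<rho> x) * k (\<theta> x) \<partial>\<mu>)) at_top"
  proof (rule Lim_transform_eventually)
    have "\<forall>\<^sub>F u in at_top. 0 < V (l * u)"
      by (rule eventually_scaled_at_top[OF V_pos assms(3)])
    then show "\<forall>\<^sub>F u in at_top. V (l * u) / V u * (?P b a (l * u) / V (l * u)) = ?P (l * b) (l * a) u / V u"
    proof eventually_elim
      case (elim u)
      have "ramp b a (r / (l * u)) = ramp (l * b) (l * a) (r / u)" for r
        using ramp_mult[OF assms(3), of b a "r / (l * u)"] assms(3) by simp
      then show ?case using elim by simp
    qed
  qed
qed

lemma mu_trunc_ramp_bounds: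
  assumes "0 < b" "b < a"
  shows "mu_trunc k a \<le> (\<integral>x. ramp b a (\<rho> x) * k (\<theta> x) \<partial>\<mu>)"
    and "(\<integral>x. ramp b a (\<rho> x) * k (\<theta> x) \<partial>\<mu>) \<le> mu_trunc k b"
proof -
  have rho_meas: "\<rho> \<in> borel_measurable (restrict_space borel (- {z}))"
    by (intro measurable_restrict_space1 borel_measurable_modulus)
  have int: "integrable \<mu> (\<lambda>x. h (\<rho> x) * k (\<theta> x))"
    if h: "h \<in> borel_measurable borel" "\<And>r. 0 \<le> h r \<and> h r \<le> indicator {b<..} r" for h :: "real \<Rightarrow> real"
  proof (rule integrable_mu[where b = b and B = B])
    show "(\<lambda>x. h (\<rho> x) * k (\<theta> x)) \<in> borel_measurable (restrict_space borel (- {z}))"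
      by (intro borel_measurable_times measurable_compose[OF rho_meas h(1)] borel_measurable_angle_continuous k)
    show "\<bar>h (\<rho> x) * k (\<theta> x)\<bar> \<le> B" if "x \<noteq> z" for x
    proof -
      have "h (\<rho> x) \<le> 1" using h(2)[of "\<rho> x"] by (cases "b < \<rho> x") auto
      then show ?thesis
        using B[OF angle_in_unit_sphere[OF that]] h(2)[of "\<rho> x"]
          mult_mono[of "h (\<rho> x)" 1 "k (\<theta> x)" B] by (simp add: abs_mult)
    qed
    show "h (\<rho> x) * k (\<theta> x) = 0" if "\<rho> x \<le> b" for x
      using h(2)[of "\<rho> x"] that by simp
  qed (fact assms(1))
  have int_ramp: "integrable \<mu> (\<lambda>x. ramp b a (\<rho> x) * k (\<theta> x))"
    by (intro int borel_measurable_ramp conjI ramp_nonneg ramp_bounds assms)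
  have int_ind: "integrable \<mu> (\<lambda>x. indicator {c<..} (\<rho> x) * k (\<theta> x))" if "b \<le> c" for c
    using that by (intro int) (auto simp: indicator_def)
  have k_nonneg: "0 \<le> k (\<theta> x)" if "x \<in> space \<mu>" for x
    using that B[OF angle_in_unit_sphere, of x] by (simp add: space_mu)
  show "mu_trunc k a \<le> (\<integral>x. ramp b a (\<rho> x) * k (\<theta> x) \<partial>\<mu>)"
    unfolding mu_trunc_def using assms
    by (intro integral_mono int_ramp int_ind mult_right_mono ramp_bounds k_nonneg) auto
  show "(\<integral>x. ramp b a (\<rho> x) * k (\<theta> x) \<partial>\<mu>) \<le> mu_trunc k b"
    unfolding mu_trunc_def using assms
    by (intro integral_mono int_ramp int_ind mult_right_mono ramp_bounds k_nonneg) auto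
qed

text \<open>Continuity of \<open>mu_trunc k\<close> in the threshold is not yet available, so
  homogeneity is carried from ramps to indicators by an inequality. A ramp from \<open>y\<close> to
  \<open>a\<close>, rescaled by \<open>x / a\<close> so that its upper end falls on
  \<open>x\<close>, yields \<open>x powr \<alpha> * mu_trunc k x \<le> a powr \<alpha> * mu_trunc k
  y\<close>. Letting \<open>a\<close> decrease to \<open>y\<close> and exchanging the roles of
  \<open>x\<close> and \<open>y\<close> makes \<open>x powr \<alpha> * mu_trunc k x\<close>
  constant.\<close>

lemma mu_trunc_powr:
  assumes "0 < a"
  shows "mu_trunc k a = a powr - \<alpha> * mu_trunc k 1"
proof -
  have le: "x powr \<alpha> * mu_trunc k x \<le> y powr \<alpha> * mu_trunc k y" if "0 < x" "0 < y" for x y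
  proof (rule tendsto_lowerbound)
    show "((\<lambda>a. a powr \<alpha> * mu_trunc k y) \<longlongrightarrow> y powr \<alpha> * mu_trunc k y) (at_right y)"
      using that by (intro tendsto_intros) auto
    have "x powr \<alpha> * mu_trunc k x \<le> a powr \<alpha> * mu_trunc k y" if "y < a" for a
    proof -
      define l where "l = x / a"
      have l: "0 < l" "l * a = x" using \<open>0 < x\<close> \<open>0 < y\<close> that by (auto simp: l_def)
      have "mu_trunc k x \<le> (\<integral>x. ramp (l * y) (l * a) (\<rho> x) * k (\<theta> x) \<partial>\<mu>)"
        unfolding l(2)[symmetric] using l(1) that \<open>0 < y\<close> by (intro mu_trunc_ramp_bounds) auto
      also have "\<dots> = l powr - \<alpha> * (\<integral>x. ramp y a (\<rho> x) * k (\<theta> x) \<partial>\<mu>)"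
        using l(1) that \<open>0 < y\<close> by (intro integral_ramp_mu_mult)
      also have "\<dots> \<le> l powr - \<alpha> * mu_trunc k y"
        using that \<open>0 < y\<close> by (intro mult_left_mono mu_trunc_ramp_bounds) auto
      finally have "x powr \<alpha> * mu_trunc k x \<le> x powr \<alpha> * (l powr - \<alpha> * mu_trunc k y)"
        by (intro mult_left_mono) auto
      also have "x powr \<alpha> * (l powr - \<alpha> * mu_trunc k y) = a powr \<alpha> * mu_trunc k y"
        using \<open>0 < x\<close> \<open>0 < y\<close> that by (simp add: l_def powr_divide powr_minus)
      finally show ?thesis .
    qed
    then show "\<forall>\<^sub>F a in at_right y. x powr \<alpha> * mu_trunc k x \<le> a powr \<alpha> * mu_trunc k y"
      by (intro eventually_mono[OF eventually_at_right_less]) auto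
  qed simp
  have "a powr \<alpha> * mu_trunc k a = mu_trunc k 1"
    using le[OF assms, of 1] le[OF _ assms, of 1] by simp
  then show ?thesis using assms by (simp add: powr_minus field_simps)
qed

lemma trunc_conv:
  assumes "0 < a"
  shows "((\<lambda>u. trunc k (a * u) / V u) \<longlongrightarrow> a powr - \<alpha> * mu_trunc k 1) at_top"
proof (rule tendsto_squeeze_thresholds[where c = 0 and q = "\<lambda>u a. trunc k (a * u) / V u"
      and h = "\<lambda>a. a powr - \<alpha> * mu_trunc k 1"
      and p = "\<lambda>u b a. (\<integral>\<omega>. ramp b a (\<rho> (X \<omega>) / u) * k (\<theta> (X \<omega>)) \<partial>M) / V u"
      and l = "\<lambda>b a. \<integral>x. ramp b a (\<rho> x) * k (\<theta> x) \<partial>\<mu>"])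
  fix b a :: real assume ba: "0 \<le> b" "b < a"
  show "\<forall>\<^sub>F u in at_top.
      trunc k (a * u) / V u \<le> (\<integral>\<omega>. ramp b a (\<rho> (X \<omega>) / u) * k (\<theta> (X \<omega>)) \<partial>M) / V u \<and>
      (\<integral>\<omega>. ramp b a (\<rho> (X \<omega>) / u) * k (\<theta> (X \<omega>)) \<partial>M) / V u \<le> trunc k (b * u) / V u"
    using V_pos eventually_gt_at_top[of 0]
    by eventually_elim (intro conjI divide_right_mono trunc_ramp_bounds[OF _ ba k B], auto)
next
  fix b a :: real assume ba: "0 < b" "b < a"
  show "((\<lambda>u. (\<integral>\<omega>. ramp b a (\<rho> (X \<omega>) / u) * k (\<theta> (X \<omega>)) \<partial>M) / V u)
      \<longlongrightarrow> (\<integral>x. ramp b a (\<rho> x) * k (\<theta> x) \<partial>\<mu>)) at_top"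
    by (rule ramp_conv[OF ba])
  show "a powr - \<alpha> * mu_trunc k 1 \<le> (\<integral>x. ramp b a (\<rho> x) * k (\<theta> x) \<partial>\<mu>) \<and>
      (\<integral>x. ramp b a (\<rho> x) * k (\<theta> x) \<partial>\<mu>) \<le> b powr - \<alpha> * mu_trunc k 1"
    using mu_trunc_ramp_bounds[OF ba] mu_trunc_powr[of a] mu_trunc_powr[of b] ba by simp
next
  show "isCont (\<lambda>a. a powr - \<alpha> * mu_trunc k 1) a"
    using assms by (auto intro!: continuous_intros)
qed fact

end

text \<open>If \<open>{x. 1 < \<rho> x}\<close> were null, homogeneity would make every
  \<open>{x. inverse (real (Suc n)) < \<rho> x}\<close> null. These sets exhaust the space without
  its origin, so \<open>\<mu>\<close> would be zero.\<close>

lemma emeasure_mu_exceed: "emeasure \<mu> {x. 1 < \<rho> x} \<noteq> 0" "emeasure \<mu> {x. 1 < \<rho> x} \<noteq> \<infinity>"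
  and mu_trunc_1: "mu_trunc (\<lambda>_. 1) 1 = measure \<mu> {x. 1 < \<rho> x}"
proof -
  have fin: "emeasure \<mu> {x. a < \<rho> x} \<noteq> \<infinity>" if "0 < a" for a
    using emeasure_M0_finite[OF \<mu>(1) that] by simp
  have sets: "{x. a < \<rho> x} \<in> sets \<mu>" if "0 < a" for a
    unfolding sets_mu using that by (intro sets_modulus_greater) simp
  have val: "mu_trunc (\<lambda>_. 1) a = measure \<mu> {x. a < \<rho> x}" if "0 < a" for a
  proof -
    have "mu_trunc (\<lambda>_. 1) a = (\<integral>x. indicator {x. a < \<rho> x} x \<partial>\<mu>)"
      unfolding mu_trunc_def by (intro Bochner_Integration.integral_cong) (auto simp: indicator_def)
    also have "\<dots> = measure \<mu> {x. a < \<rho> x}"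
      using sets.sets_into_space[OF sets[OF that]] sets[OF that] by (simp add: Int_absorb2)
    finally show ?thesis .
  qed
  show "mu_trunc (\<lambda>_. 1) 1 = measure \<mu> {x. 1 < \<rho> x}" by (simp add: val)
  show "emeasure \<mu> {x. 1 < \<rho> x} \<noteq> \<infinity>" by (rule fin) simp
  show "emeasure \<mu> {x. 1 < \<rho> x} \<noteq> 0"
  proof
    assume "emeasure \<mu> {x. 1 < \<rho> x} = 0"
    then have 0: "measure \<mu> {x. 1 < \<rho> x} = 0" by (simp add: measure_def)
    have "emeasure \<mu> {x. inverse (real (Suc n)) < \<rho> x} = 0" for n
    proof -
      have "measure \<mu> {x. inverse (real (Suc n)) < \<rho> x} = 0"
        using mu_trunc_powr[of "\<lambda>_. 1" 1 "inverse (real (Suc n))"] by (simp add: val 0 del: of_nat_Suc)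
      then show ?thesis
        using fin[of "inverse (real (Suc n))"] by (simp add: measure_def enn2real_eq_0_iff del: of_nat_Suc)
    qed
    then have "(\<Union>n. {x. inverse (real (Suc n)) < \<rho> x}) \<in> null_sets \<mu>"
      using sets by (intro null_sets_UN) (auto simp: null_sets_def simp del: of_nat_Suc)
    moreover have "(\<Union>n. {x. inverse (real (Suc n)) < \<rho> x}) = space \<mu>"
    proof
      show "(\<Union>n. {x. inverse (real (Suc n)) < \<rho> x}) \<subseteq> space \<mu>"
        by (intro UN_least sets.sets_into_space sets) simp
      show "space \<mu> \<subseteq> (\<Union>n. {x. inverse (real (Suc n)) < \<rho> x})"
        using reals_Archimedean by (force simp: space_mu simp flip: modulus_pos_iff)
    qed
    ultimately show False using \<mu>(2) by auto
  qed
qed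

lemma tail_conv:
  "0 < a \<Longrightarrow> ((\<lambda>u. tail (a * u) / V u) \<longlongrightarrow> a powr - \<alpha> * measure \<mu> {x. 1 < \<rho> x}) at_top"
  using trunc_conv[of "\<lambda>_. 1" 1 a] by (simp add: trunc_1 mu_trunc_1)

lemma measure_mu_pos: "0 < measure \<mu> {x. 1 < \<rho> x}"
  using emeasure_mu_exceed by (simp add: measure_def enn2real_positive_iff less_top zero_less_iff_neq_zero)

text \<open>Both \<open>tail (l * u) / V u\<close> and \<open>tail u / V u\<close> converge, the
  latter to a positive number, so \<open>V\<close> cancels in the quotient.\<close>

lemma reg_var_of_M0_conv: "reg_var (- \<alpha>) tail"
proof (rule reg_var_tailI)
  have "((\<lambda>u. tail u / V u) \<longlongrightarrow> measure \<mu> {x. 1 < \<rho> x}) at_top"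
    using tail_conv[of 1] by simp
  then have "\<forall>\<^sub>F u in at_top. 0 < tail u / V u"
    using measure_mu_pos by (rule order_tendstoD)
  with V_pos show "\<forall>\<^sub>F u in at_top. 0 < tail u"
    by eventually_elim (simp add: zero_less_divide_iff)
  fix l :: real assume "0 < l"
  have "((\<lambda>u. (tail (l * u) / V u) / (tail (1 * u) / V u)) \<longlongrightarrow>
      (l powr - \<alpha> * measure \<mu> {x. 1 < \<rho> x}) / (1 powr - \<alpha> * measure \<mu> {x. 1 < \<rho> x})) at_top"
    using measure_mu_pos \<open>0 < l\<close> by (intro tendsto_divide tail_conv) auto
  then have lim: "((\<lambda>u. (tail (l * u) / V u) / (tail (1 * u) / V u)) \<longlongrightarrow> l powr - \<alpha>) at_top"
    using measure_mu_pos by simp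
  show "((\<lambda>u. tail (l * u) / tail u) \<longlongrightarrow> l powr - \<alpha>) at_top"
    by (rule Lim_transform_eventually[OF lim], rule eventually_mono[OF V_pos]) simp
qed

lemma angle_conv_of_M0_conv:
  defines "H \<equiv> cond_law \<mu> {x. 1 < \<rho> x} S1 \<theta>"
  shows "prob_on (unit_sphere \<rho>) H" "weak_tendsto (unit_sphere \<rho>) angle_law H at_top"
proof -
  have E: "{x. 1 < \<rho> x} \<in> sets \<mu>"
    unfolding sets_mu by (intro sets_modulus_greater) simp
  have "\<theta> \<in> measurable \<mu> S1"
    using measurable_angle by (simp only: measurable_cong_sets[OF sets_mu refl])
  then have meas: "\<theta> \<in> measurable (restrict_space \<mu> {x. 1 < \<rho> x}) S1"
    by (rule measurable_restrict_space1)
  have prob_H: "prob_space H"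
    unfolding H_def by (rule prob_space_cond_law[OF E emeasure_mu_exceed meas])
  then show "prob_on (unit_sphere \<rho>) H" by (simp add: prob_on_def H_def)
  interpret H: prob_space H by (rule prob_H)
  have space_H: "space H = unit_sphere \<rho>"
    by (rule prob_on_D(3)) fact
  show "weak_tendsto (unit_sphere \<rho>) angle_law H at_top"
    unfolding weak_tendsto_def
  proof (intro allI impI, elim conjE)
    fix k :: "'a \<Rightarrow> real"
    assume k: "continuous_on (unit_sphere \<rho>) k" "bounded (k ` unit_sphere \<rho>)"
    then obtain B where B: "\<And>x. x \<in> unit_sphere \<rho> \<Longrightarrow> \<bar>k x\<bar> \<le> B" by (auto simp: bounded_iff)
    \<comment> \<open>\<open>trunc_conv\<close> requires a nonnegative function. The shift adds
      \<open>B * tail u\<close> to the truncated integral, that is, the constant \<open>B\<close>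
      after normalisation, which is subtracted again below.\<close>
    let ?k = "\<lambda>x. k x + B"
    have k': "continuous_on (unit_sphere \<rho>) ?k" by (intro continuous_intros k)
    have "0 \<le> ?k x \<and> ?k x \<le> 2 * B" if "x \<in> unit_sphere \<rho>" for x
      using B[OF that] by (auto simp: abs_le_iff)
    from trunc_conv[OF k' this, of 1]
    have "((\<lambda>u. trunc ?k u / V u) \<longlongrightarrow> mu_trunc ?k 1) at_top" by simp
    moreover have "((\<lambda>u. tail u / V u) \<longlongrightarrow> measure \<mu> {x. 1 < \<rho> x}) at_top"
      using tail_conv[of 1] by simp
    ultimately have "((\<lambda>u. (trunc ?k u / V u) / (tail u / V u) - B)
        \<longlongrightarrow> mu_trunc ?k 1 / measure \<mu> {x. 1 < \<rho> x} - B) at_top"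
      using measure_mu_pos by (intro tendsto_intros) auto
    moreover have "mu_trunc ?k 1 / measure \<mu> {x. 1 < \<rho> x} - B = (\<integral>x. k x \<partial>H)"
    proof -
      have "(\<integral>x. ?k x \<partial>H) = (\<integral>x. indicator {x. 1 < \<rho> x} x * ?k (\<theta> x) \<partial>\<mu>) / measure \<mu> {x. 1 < \<rho> x}"
        unfolding H_def
        by (rule integral_cond_law[OF E emeasure_mu_exceed(2) meas borel_measurable_continuous_on_restrict[OF k']])
      also have "(\<integral>x. indicator {x. 1 < \<rho> x} x * ?k (\<theta> x) \<partial>\<mu>) = mu_trunc ?k 1"
        unfolding mu_trunc_def by (intro Bochner_Integration.integral_cong) (auto simp: indicator_def)
      finally have "mu_trunc ?k 1 / measure \<mu> {x. 1 < \<rho> x} = (\<integral>x. ?k x \<partial>H)" by simp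
      moreover have "integrable H k"
      proof (rule H.integrable_const_bound[of _ B], rule AE_I2)
        show "norm (k x) \<le> B" if "x \<in> space H" for x using B that by (simp add: space_H)
        have sets_H: "sets H = sets S1" by (simp add: H_def)
        show "k \<in> borel_measurable H"
          using borel_measurable_continuous_on_restrict[OF k(1)]
          unfolding measurable_cong_sets[OF sets_H refl] .
      qed
      ultimately show ?thesis by (simp add: H.prob_space)
    qed
    ultimately have "((\<lambda>u. (trunc ?k u / V u) / (tail u / V u) - B) \<longlongrightarrow> (\<integral>x. k x \<partial>H)) at_top" by simp
    then show "((\<lambda>u. \<integral>x. k x \<partial>angle_law u) \<longlongrightarrow> (\<integral>x. k x \<partial>H)) at_top"
    proof (rule Lim_transform_eventually)
      show "\<forall>\<^sub>F u in at_top. (trunc ?k u / V u) / (tail u / V u) - B = (\<integral>x. k x \<partial>angle_law u)"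
        using V_pos tail_pos_of_reg_var[OF reg_var_of_M0_conv] eventually_ge_at_top[of 0]
      proof eventually_elim
        case (elim u)
        then show ?case
          by (simp add: integral_angle_law k(1) trunc_add_const[OF _ k(1) B] divide_simps)
      qed
    qed
  qed
qed

end

lemma angle_conv_of_regularly_varying:
  assumes "regularly_varying z smul M X \<alpha>"
  shows "reg_var (- \<alpha>) tail"
    "\<exists>H. prob_on (unit_sphere \<rho>) H \<and> weak_tendsto (unit_sphere \<rho>) angle_law H at_top"
  using assms reg_var_of_M0_conv angle_conv_of_M0_conv unfolding regularly_varying_def by blast+

end

theorem proposition3p1:
  fixes z :: "'a::polish_space"
    and smul :: "real \<Rightarrow> 'a \<Rightarrow> 'a"
    and \<rho> :: "'a \<Rightarrow> real"
    and M :: "'b measure"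
    and X :: "'b \<Rightarrow> 'a"
    and \<alpha> :: real
  assumes "(UNIV :: 'a set) \<noteq> {z}"
    and "scalar_mult z smul"
    and "modulus z smul \<rho>"
    and "prob_space M"
    and "X \<in> measurable M borel"
    and "0 < \<alpha>"
  shows "let S1 = restrict_space borel (unit_sphere \<rho>);
             \<theta> = angle smul \<rho>;
             exceed = (\<lambda>u. {\<omega> \<in> space M. \<rho> (X \<omega>) > u});
             tail = (\<lambda>u. measure M (exceed u));
             angle_conv = (\<lambda>H. weak_tendsto (unit_sphere \<rho>)
               (\<lambda>u. cond_law M (exceed u) S1 (\<lambda>\<omega>. \<theta> (X \<omega>))) H at_top);
             polar_conv = (\<lambda>H. weak_tendsto (UNIV \<times> unit_sphere \<rho>)
               (\<lambda>u. cond_law M (exceed u) (borel \<Otimes>\<^sub>M S1) (\<lambda>\<omega>. (\<rho> (X \<omega>) / u, \<theta> (X \<omega>))))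
               (pareto \<alpha> \<Otimes>\<^sub>M H) at_top);
             has_polar_form = (\<lambda>\<mu> H.
               distr \<mu> (restrict_space borel {0<..} \<Otimes>\<^sub>M S1) (\<lambda>x. (\<rho> x, \<theta> x)) =
               density (restrict_space lborel {0<..}) (\<lambda>r. ennreal (\<alpha> * r powr (- \<alpha> - 1))) \<Otimes>\<^sub>M H)
         in
           (regularly_varying z smul M X \<alpha> \<longleftrightarrow>
              reg_var (- \<alpha>) tail \<and> (\<exists>H. prob_on (unit_sphere \<rho>) H \<and> angle_conv H)) \<and>
           (regularly_varying z smul M X \<alpha> \<longleftrightarrow>
              (\<exists>H. prob_on (unit_sphere \<rho>) H \<and> polar_conv H)) \<and>
           (\<forall>H. prob_on (unit_sphere \<rho>) H \<and> (reg_var (- \<alpha>) tail \<and> angle_conv H \<or> polar_conv H) \<longrightarrow>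
              (\<exists>\<mu>\<in>M0 z. has_polar_form \<mu> H \<and> (\<forall>\<nu>\<in>M0 z. has_polar_form \<nu> H \<longrightarrow> \<nu> = \<mu>) \<and>
                 M0_tendsto z
                   (\<lambda>u. scale_measure (ennreal (inverse (tail u))) (scaled_law z smul M X u))
                   \<mu> at_top))"
proof -
  interpret prob_space M by fact
  interpret polar_variable z smul \<rho> M X \<alpha>
    using assms by unfold_locales auto
  \<comment> \<open>Either description of \<open>H\<close> yields polar convergence with the same
    \<open>H\<close>, so the limit statement and the return to (i) need this single case.\<close>
  have polar: "weak_tendsto (UNIV \<times> unit_sphere \<rho>) polar_law (pareto \<alpha> \<Otimes>\<^sub>M H) at_top"
    if "prob_on (unit_sphere \<rho>) H" "reg_var (- \<alpha>) tail \<and> weak_tendsto (unit_sphere \<rho>) angle_law H at_top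
      \<or> weak_tendsto (UNIV \<times> unit_sphere \<rho>) polar_law (pareto \<alpha> \<Otimes>\<^sub>M H) at_top" for H
    using that polar_conv_of_angle_conv by blast
  show ?thesis
    unfolding Let_def
  proof (intro conjI allI impI)
    show "regularly_varying z smul M X \<alpha> \<longleftrightarrow> reg_var (- \<alpha>) tail \<and>
        (\<exists>H. prob_on (unit_sphere \<rho>) H \<and> weak_tendsto (unit_sphere \<rho>) angle_law H at_top)"
      using angle_conv_of_regularly_varying polar regularly_varying_of_polar_conv by blast
    show "regularly_varying z smul M X \<alpha> \<longleftrightarrow> (\<exists>H. prob_on (unit_sphere \<rho>) H \<and>
        weak_tendsto (UNIV \<times> unit_sphere \<rho>) polar_law (pareto \<alpha> \<Otimes>\<^sub>M H) at_top)"
      using angle_conv_of_regularly_varying polar regularly_varying_of_polar_conv by blast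
    fix H
    assume *: "prob_on (unit_sphere \<rho>) H \<and>
      (reg_var (- \<alpha>) tail \<and> weak_tendsto (unit_sphere \<rho>) angle_law H at_top
      \<or> weak_tendsto (UNIV \<times> unit_sphere \<rho>) polar_law (pareto \<alpha> \<Otimes>\<^sub>M H) at_top)"
    then have H: "prob_on (unit_sphere \<rho>) H" by blast
    show "\<exists>\<mu>\<in>M0 z. has_polar_form \<alpha> \<mu> H \<and> (\<forall>\<nu>\<in>M0 z. has_polar_form \<alpha> \<nu> H \<longrightarrow> \<nu> = \<mu>) \<and>
        M0_tendsto z (\<lambda>u. scale_measure (ennreal (inverse (tail u))) (scaled_law z smul M X u)) \<mu> at_top"
    proof (intro bexI[of _ "polar_measure \<alpha> H"] conjI ballI impI)
      show "\<nu> = polar_measure \<alpha> H" if "\<nu> \<in> M0 z" "has_polar_form \<alpha> \<nu> H" for \<nu>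
        using that by (intro polar_form_imp_eq_polar_measure \<alpha> H) (simp_all add: M0_def)
    qed (use * polar in \<open>auto intro: polar_form_polar_measure polar_measure_in_M0
      M0_tendsto_polar_measure \<alpha>\<close>)
  qed
qed

end
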